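(* Let $k$ be an algebraically closed field of characteristic $0$, let $s_1,s_2\in k$ with $27-18s_1s_2-s_1^2s_2^2+4s_1^3+4s_2^3\neq 0$, and let $K=k(X,Y)$ be the genus $2$ field given by $Y^2=X^6-s_1X^4+s_2X^2-1$. Put $u=s_1s_2$ and $v=s_1^3+s_2^3$, and let $E_1=k(X^2,Y)$ and $E_2=k(X^2,XY)$ be its paired degree $2$ elliptic subfields. Suppose $E_1$ and $E_2$ are isogenous of degree $2$. Then $$f_1(u,v)\cdot f_2(u,v)=0,$$ where $$\begin{aligned} f_1={}&-16v^3-81216v^2-892296v-2460375+3312uv^2+707616vu+3805380u\\ &+18360vu^2-1296162u^2-1744u^3v-140076u^3+801u^4+256u^5, \end{aligned}$$ $$\begin{aligned} f_2={}&4096u^7+256016u^6-45824u^5v+4736016u^5-2126736vu^4+23158143u^4\\ &-25451712u^3v-119745540u^3+5291136v^2u^2-48166488vu^2-2390500350u^2\\ &-179712uv^3+35831808uv^2+1113270480vu+9300217500u-4036608v^3\\ &-1791153000v-8303765625-1024v^4+163840u^3v^2-122250384v^2+256u^2v^3 . \end{aligned}$$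
   Context: Elliptic subfields are identified with the corresponding elliptic curves over $k$; an isogeny of degree $2$ between two elliptic curves exists if and only if their $j$-invariants satisfy $\Phi_2(j_1,j_2)=0$, where $\Phi_2$ is the classical modular polynomial of level 2. *)

theory Defs
  imports "HOL-Algebra.Algebraic_Closure_Type" "HOL-Algebra.Generated_Fields"
begin

text \<open>
  Curves over an algebraically closed field \<open>k\<close> are represented by their function fields, which
  are subfields of an ambient field \<open>R\<close> containing \<open>k\<close>.  A point of the curve is a place of its
  function field \<open>F\<close>, given by its valuation ring: a ring \<open>k \<subset> P \<subset> F\<close> containing \<open>z\<close> or \<open>1/z\<close>
  for every nonzero \<open>z\<close> in \<open>F\<close>.
\<close>

definition place_of :: "('a, 'b) ring_scheme \<Rightarrow> 'a set \<Rightarrow> 'a set \<Rightarrow> 'a set \<Rightarrow> bool" where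
  "place_of R k F P \<longleftrightarrow>
     subring P R \<and> k \<subset> P \<and> P \<subset> F \<and> (\<forall>z\<in>F - {\<zero>\<^bsub>R\<^esub>}. z \<in> P \<or> inv\<^bsub>R\<^esub> z \<in> P)"

text \<open>
  An elliptic curve is a genus one function field \<open>E\<close> together with a place \<open>O\<^sub>E\<close>, its origin.
  An isogeny \<open>(E, O\<^sub>E) \<rightarrow> (F, O\<^sub>F)\<close> is a nonconstant morphism of curves mapping \<open>O\<^sub>E\<close> to \<open>O\<^sub>F\<close>.
  Contravariantly it is a \<open>k\<close>-embedding \<open>\<phi> : F \<rightarrow> E\<close> under which the place \<open>O\<^sub>E\<close> restricts to
  \<open>O\<^sub>F\<close>, and its degree is \<open>[E : \<phi>(F)]\<close>.
\<close>

definition isogeny_of_degree ::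
  "('a, 'b) ring_scheme \<Rightarrow> 'a set \<Rightarrow> nat \<Rightarrow> 'a set \<Rightarrow> 'a set \<Rightarrow> 'a set \<Rightarrow> 'a set \<Rightarrow> ('a \<Rightarrow> 'a) \<Rightarrow> bool"
  where
  "isogeny_of_degree R k n E O\<^sub>E F O\<^sub>F \<phi> \<longleftrightarrow>
     \<phi> \<in> ring_hom (R\<lparr>carrier := F\<rparr>) (R\<lparr>carrier := E\<rparr>) \<and>
     (\<forall>c\<in>k. \<phi> c = c) \<and>
     {z \<in> F. \<phi> z \<in> O\<^sub>E} = O\<^sub>F \<and>
     ring.dimension R n (\<phi> ` F) E"

text \<open>
  An elliptic subfield comes without a distinguished origin, and translations act transitively on
  the points of the curve, so the origins are quantified existentially.  The relation is symmetric
  by definition; since every isogeny has a dual of the same degree, either disjunct alone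
  describes the same relation between elliptic function fields.
\<close>

definition isogenous_of_degree ::
  "('a, 'b) ring_scheme \<Rightarrow> 'a set \<Rightarrow> nat \<Rightarrow> 'a set \<Rightarrow> 'a set \<Rightarrow> bool" where
  "isogenous_of_degree R k n E F \<longleftrightarrow>
     (\<exists>O\<^sub>E O\<^sub>F \<phi>. place_of R k E O\<^sub>E \<and> place_of R k F O\<^sub>F \<and>
        (isogeny_of_degree R k n E O\<^sub>E F O\<^sub>F \<phi> \<or> isogeny_of_degree R k n F O\<^sub>F E O\<^sub>E \<phi>))"

definition isog2_f1 :: "'k::comm_ring_1 \<Rightarrow> 'k \<Rightarrow> 'k" where
  "isog2_f1 u v =
     - 16*v^3 - 81216*v^2 - 892296*v - 2460375 + 3312*u*v^2 + 707616*v*u + 3805380*u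
     + 18360*v*u^2 - 1296162*u^2 - 1744*u^3*v - 140076*u^3 + 801*u^4 + 256*u^5"

definition isog2_f2 :: "'k::comm_ring_1 \<Rightarrow> 'k \<Rightarrow> 'k" where
  "isog2_f2 u v =
     4096*u^7 + 256016*u^6 - 45824*u^5*v + 4736016*u^5 - 2126736*v*u^4 + 23158143*u^4
     - 25451712*u^3*v - 119745540*u^3 + 5291136*v^2*u^2 - 48166488*v*u^2 - 2390500350*u^2
     - 179712*u*v^3 + 35831808*u*v^2 + 1113270480*v*u + 9300217500*u - 4036608*v^3
     - 1791153000*v - 8303765625 - 1024*v^4 + 163840*u^3*v^2 - 122250384*v^2 + 256*u^2*v^3"

end

theory Submission
  imports Defs
begin

text \<open>
  Write the two curves as \<open>M = k(\<alpha>, \<beta>)\<close>, \<open>\<beta>\<^sup>2 = f(\<alpha>)\<close>, and \<open>L = k(t, w)\<close>, \<open>w\<^sup>2 = g(t)\<close>, with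
  \<open>f\<close>, \<open>g\<close> cubic and \<open>M \<subset> L\<close> of index 2.  The line through the point \<open>(\<alpha>, \<beta>)\<close> of \<open>E: y\<^sup>2 = f(x)\<close> and
  its conjugate under \<open>w \<mapsto> -w\<close> meets \<open>E\<close> in a third point with coordinates in \<open>k(t)\<close>, which must be
  constant.  Projecting \<open>E\<close> from this third point gives \<open>M = k(m, \<delta>)\<close> with \<open>m \<in> k(t)\<close>,
  \<open>\<delta> \<in> k(t) w\<close> and \<open>\<delta>\<^sup>2 = D(m)\<close> for a quartic \<open>D\<close> with the \<open>j\<close>-invariant of \<open>f\<close>.  Index 2 forces
  \<open>m = p/q\<close> to have degree 2, and clearing denominators gives \<open>D(p, q) = g s\<^sup>2\<close> with binary quartic
  forms \<open>D\<close>.  Every root of \<open>s\<close> is a ramification point of \<open>p/q\<close>, so \<open>s\<close> divides the Wronskian of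
  \<open>p\<close> and \<open>q\<close>; counting degrees, the two agree up to a constant.  In coordinates adapted to the two
  ramification points \<open>D = U V (a U\<^sup>2 + b U V + c V\<^sup>2)\<close> and \<open>g = a U\<^sup>4 + b U\<^sup>2 V\<^sup>2 + c V\<^sup>4\<close>, for which
  \<open>\<Phi>\<^sub>2\<close> vanishes identically.  Finally \<open>\<Phi>\<^sub>2(j\<^sub>1, j\<^sub>2) \<Delta>\<^sup>4 = -4096 f\<^sub>1 f\<^sub>2\<close>, where \<open>\<Delta>\<close> is the common
  discriminant of the two cubics.
\<close>

section \<open>Binary quartic forms\<close>

definition qform :: "'a::comm_ring_1 \<Rightarrow> 'a \<Rightarrow> 'a \<Rightarrow> 'a \<Rightarrow> 'a \<Rightarrow> 'a \<Rightarrow> 'a \<Rightarrow> 'a" where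
  "qform a b c d e U V = a*U^4 + b*U^3*V + c*U^2*V^2 + d*U*V^3 + e*V^4"

text \<open>
  The classical invariants of degree 2 and 3, normalised so that \<open>4 I\<^sup>3 - J\<^sup>2\<close> is 27 times the
  discriminant.  A cubic is the quartic form with \<open>a = 0\<close>, i.e. with a root at infinity.
\<close>

definition invI :: "'a::comm_ring_1 \<Rightarrow> 'a \<Rightarrow> 'a \<Rightarrow> 'a \<Rightarrow> 'a \<Rightarrow> 'a" where
  "invI a b c d e = 12*a*e - 3*b*d + c^2"

definition invJ :: "'a::comm_ring_1 \<Rightarrow> 'a \<Rightarrow> 'a \<Rightarrow> 'a \<Rightarrow> 'a \<Rightarrow> 'a" where
  "invJ a b c d e = 72*a*c*e + 9*b*c*d - 27*a*d^2 - 27*e*b^2 - 2*c^3"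

definition qdisc :: "'a::comm_ring_1 \<Rightarrow> 'a \<Rightarrow> 'a \<Rightarrow> 'a \<Rightarrow> 'a \<Rightarrow> 'a" where
  "qdisc a b c d e = 4 * invI a b c d e ^ 3 - invJ a b c d e ^ 2"

text \<open>The j-invariant of the curve \<open>y^2 = qform a b c d e x 1\<close>; since 6912 = 4 *
  1728, it takes the value 1728 on nondegenerate forms with \<open>invJ = 0\<close>.\<close>

definition qj :: "'a::field \<Rightarrow> 'a \<Rightarrow> 'a \<Rightarrow> 'a \<Rightarrow> 'a \<Rightarrow> 'a" where
  "qj a b c d e = 6912 * invI a b c d e ^ 3 / qdisc a b c d e"

text \<open>The classical modular polynomial of level 2, for the normalisation of the j-invariant in
  \<open>qj\<close>.\<close>

definition Phi2 :: "'a::comm_ring_1 \<Rightarrow> 'a \<Rightarrow> 'a" where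
  "Phi2 x y = x^3 + y^3 - x^2*y^2 + 1488*(x^2*y + x*y^2) - 162000*(x^2 + y^2)
     + 40773375*x*y + 8748000000*(x + y) - 157464000000000"

lemma Phi2_sym: "Phi2 x y = Phi2 y x"
  by (simp add: Phi2_def algebra_simps)

lemma qform_swap: "qform a b c d e U V = qform e d c b a V U"
  by (simp add: qform_def algebra_simps)

lemma qdisc_swap: "qdisc a b c d e = qdisc e d c b a"
  by (simp add: qdisc_def invI_def invJ_def algebra_simps)

text \<open>The hypotheses are the partial derivatives of the form at \<open>(z, 1)\<close>. They
  are linear in \<open>d\<close> and \<open>e\<close>; once these are solved for, the discriminant
  vanishes identically.\<close>

lemma qdisc_zero_of_critical_affine:
  fixes a :: "'a::field_char_0"
  assumes "4*a*z^3 + 3*b*z^2 + 2*c*z + d = 0" "b*z^3 + 2*c*z^2 + 3*d*z + 4*e = 0"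
  shows "qdisc a b c d e = 0"
proof -
  have d: "d = -(4*a*z^3 + 3*b*z^2 + 2*c*z)" using assms(1) by Groebner_Basis.algebra
  have "4 * e = 4 * (3*a*z^4 + 2*b*z^3 + c*z^2)" using assms(2) d by Groebner_Basis.algebra
  hence e: "e = 3*a*z^4 + 2*b*z^3 + c*z^2"
    unfolding mult_cancel_left by simp
  show ?thesis unfolding qdisc_def invI_def invJ_def d e by Groebner_Basis.algebra
qed

lemma qdisc_zero_of_critical:
  fixes a :: "'a::field_char_0"
  assumes "4*a*U^3 + 3*b*U^2*V + 2*c*U*V^2 + d*V^3 = 0"
    and "b*U^3 + 2*c*U^2*V + 3*d*U*V^2 + 4*e*V^3 = 0"
    and "U \<noteq> 0 \<or> V \<noteq> 0"
  shows "qdisc a b c d e = 0"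
proof (cases "V = 0")
  case True
  hence "a = 0" "b = 0" using assms by auto
  thus ?thesis by (simp add: qdisc_def invI_def invJ_def algebra_simps power2_eq_square power3_eq_cube)
next
  case False
  define z where "z = U / V"
  have U: "U = z * V" using False by (simp add: z_def)
  have "(4*a*z^3 + 3*b*z^2 + 2*c*z + d) * V^3 = 0" "(b*z^3 + 2*c*z^2 + 3*d*z + 4*e) * V^3 = 0"
    using assms(1,2) unfolding U by Groebner_Basis.algebra+
  thus ?thesis using qdisc_zero_of_critical_affine[of a z b c d e] False by simp
qed

lemma qform_subst:
  fixes a :: "'a::idom"
  shows "qform a b c d e (n1*U + n2*V) (n3*U + n4*V) =
    qform (qform a b c d e n1 n3)
      (4*a*n1^3*n2 + b*(3*n1^2*n2*n3 + n1^3*n4) + c*(2*n1*n2*n3^2 + 2*n1^2*n3*n4) + d*(n2*n3^3 + 3*n1*n3^2*n4) + 4*e*n3^3*n4)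
      (6*a*n1^2*n2^2 + b*(3*n1*n2^2*n3 + 3*n1^2*n2*n4) + c*(n2^2*n3^2 + 4*n1*n2*n3*n4 + n1^2*n4^2) + d*(3*n2*n3^2*n4 + 3*n1*n3*n4^2) + 6*e*n3^2*n4^2)
      (4*a*n1*n2^3 + b*(n2^3*n3 + 3*n1*n2^2*n4) + c*(2*n2^2*n3*n4 + 2*n1*n2*n4^2) + d*(3*n2*n3*n4^2 + n1*n4^3) + 4*e*n3*n4^3)
      (qform a b c d e n2 n4) U V"
  unfolding qform_def by Groebner_Basis.algebra

text \<open>An invariant of degree \<open>n\<close> of a binary quartic has weight
  \<open>2 n\<close>: \<open>invI\<close> scales by the fourth power of the determinant and, below,
  \<open>invJ\<close> by the sixth.\<close>

lemma invI_subst: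
  fixes a :: "'a::idom"
  shows "invI (qform a b c d e n1 n3)
      (4*a*n1^3*n2 + b*(3*n1^2*n2*n3 + n1^3*n4) + c*(2*n1*n2*n3^2 + 2*n1^2*n3*n4) + d*(n2*n3^3 + 3*n1*n3^2*n4) + 4*e*n3^3*n4)
      (6*a*n1^2*n2^2 + b*(3*n1*n2^2*n3 + 3*n1^2*n2*n4) + c*(n2^2*n3^2 + 4*n1*n2*n3*n4 + n1^2*n4^2) + d*(3*n2*n3^2*n4 + 3*n1*n3*n4^2) + 6*e*n3^2*n4^2)
      (4*a*n1*n2^3 + b*(n2^3*n3 + 3*n1*n2^2*n4) + c*(2*n2^2*n3*n4 + 2*n1*n2*n4^2) + d*(3*n2*n3*n4^2 + n1*n4^3) + 4*e*n3*n4^3)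
      (qform a b c d e n2 n4) = (n1*n4 - n2*n3)^4 * invI a b c d e"
  unfolding qform_def invI_def by Groebner_Basis.algebra

lemma invJ_subst:
  fixes a :: "'a::idom"
  shows "invJ (qform a b c d e n1 n3)
      (4*a*n1^3*n2 + b*(3*n1^2*n2*n3 + n1^3*n4) + c*(2*n1*n2*n3^2 + 2*n1^2*n3*n4) + d*(n2*n3^3 + 3*n1*n3^2*n4) + 4*e*n3^3*n4)
      (6*a*n1^2*n2^2 + b*(3*n1*n2^2*n3 + 3*n1^2*n2*n4) + c*(n2^2*n3^2 + 4*n1*n2*n3*n4 + n1^2*n4^2) + d*(3*n2*n3^2*n4 + 3*n1*n3*n4^2) + 6*e*n3^2*n4^2)
      (4*a*n1*n2^3 + b*(n2^3*n3 + 3*n1*n2^2*n4) + c*(2*n2^2*n3*n4 + 2*n1*n2*n4^2) + d*(3*n2*n3*n4^2 + n1*n4^3) + 4*e*n3*n4^3)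
      (qform a b c d e n2 n4) = (n1*n4 - n2*n3)^6 * invJ a b c d e"
  unfolding qform_def invJ_def by Groebner_Basis.algebra

text \<open>The left-hand side is \<open>Phi2 j1 j2 * D^4\<close> for two j-invariants with common
  denominator \<open>D\<close> whose numerators have sum \<open>256 * A\<close> and product
  \<open>65536 * B^3\<close>. Passing to these symmetric functions leaves an identity in
  \<open>u\<close> and \<open>v\<close> alone.\<close>

lemma Phi2_isog2_uv:
  fixes u v A B D :: "'a::idom"
  assumes "A = v^2 - 2*u^3 - 9*u*v + 54*u^2 - 27*v" and "B = u^2 - 3*v + 9*u"
    and "D = u^2 + 18*u - 4*v - 27"
  shows "(256*A)^3*D - 3*(256*A)*(65536*B^3)*D - (65536*B^3)^2 + 1488*(65536*B^3)*(256*A)*D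
      - 162000*((256*A)^2 * D^2 - 2*(65536*B^3)*D^2) + 40773375*(65536*B^3)*D^2
      + 8748000000*(256*A)*D^3 - 157464000000000*D^4 = -4096 * (isog2_f1 u v * isog2_f2 u v)"
  unfolding assms isog2_f1_def isog2_f2_def by Groebner_Basis.algebra

section \<open>Quartic forms in two polynomials\<close>

text \<open>Coprimality of \<open>x\<close> and \<open>y\<close> appears as absence of common roots,
  which is enough over an algebraically closed field. Linear factors of \<open>s\<close> are split
  off one by one: a root of \<open>s\<close> is a root of \<open>x * w\<close> and of
  \<open>y * w\<close>, hence of \<open>w\<close>.\<close>

lemma dvd_of_dvd_mult_no_common_root:
  fixes s :: "'k::alg_closed_field poly"
  assumes "s \<noteq> 0" "s dvd x * w" "s dvd y * w" "\<And>z. poly x z \<noteq> 0 \<or> poly y z \<noteq> 0"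
  shows "s dvd w"
  using assms(1-3)
proof (induction "degree s" arbitrary: s w)
  case 0
  thus ?case by (metis is_unit_iff_degree unit_imp_dvd)
next
  case (Suc n)
  obtain z where z: "poly s z = 0"
    using alg_closed_imp_poly_has_root[of s] Suc.hyps(2) by auto
  then obtain s' where s': "s = [:-z, 1:] * s'" by (auto simp: poly_eq_0_iff_dvd)
  have zxw: "poly (x * w) z = 0" "poly (y * w) z = 0"
    using Suc.prems z by (metis dvdE poly_mult mult_zero_left)+
  hence "poly w z = 0" using assms(4)[of z] by auto
  then obtain w' where w': "w = [:-z, 1:] * w'" by (auto simp: poly_eq_0_iff_dvd)
  have s0: "s' \<noteq> 0" using Suc.prems(1) s' by auto
  have deg: "n = degree s'" using Suc.hyps(2) s0 unfolding s' by (subst (asm) degree_mult_eq) auto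
  have "[:-z, 1:] * s' dvd [:-z, 1:] * (x * w')" "[:-z, 1:] * s' dvd [:-z, 1:] * (y * w')"
    using Suc.prems(2,3) unfolding s' w' by (simp_all only: mult.left_commute)
  hence "s' dvd x * w'" "s' dvd y * w'" by (simp_all only: dvd_mult_cancel_left, auto)
  hence "s' dvd w'" using Suc.hyps(1)[OF deg s0] by blast
  thus ?case unfolding s' w' by (rule mult_dvd_mono[OF dvd_refl])
qed

text \<open>The numerator of the derivative of \<open>p / q\<close>; for coprime \<open>p\<close>
  and \<open>q\<close> with nonconstant quotient its roots are the finite ramification points of
  this map.\<close>

definition wronskian :: "'k::idom poly \<Rightarrow> 'k poly \<Rightarrow> 'k poly" where
  "wronskian p q = pderiv p * q - p * pderiv q"

definition pform :: "'k::idom \<Rightarrow> 'k \<Rightarrow> 'k \<Rightarrow> 'k \<Rightarrow> 'k \<Rightarrow> 'k poly \<Rightarrow> 'k poly \<Rightarrow> 'k poly" where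
  "pform a b c d e p q = qform [:a:] [:b:] [:c:] [:d:] [:e:] p q"

lemma poly_pform: "poly (pform a b c d e p q) x = qform a b c d e (poly p x) (poly q x)"
  by (simp add: pform_def qform_def)

lemma pform_swap: "pform a b c d e p q = pform e d c b a q p"
  unfolding pform_def by (rule qform_swap)

lemma pderiv_pform:
  fixes p q :: "'k::idom poly"
  shows "pderiv (pform a b c d e p q) =
    (4*[:a:]*p^3 + 3*[:b:]*p^2*q + 2*[:c:]*p*q^2 + [:d:]*q^3) * pderiv p
    + ([:b:]*p^3 + 2*[:c:]*p^2*q + 3*[:d:]*p*q^2 + 4*[:e:]*q^3) * pderiv q"
proof -
  have c: "pderiv ([:r:] * s) = [:r:] * pderiv s" for r and s :: "'k poly" by (simp add: pderiv_smult)
  have "pderiv (pform a b c d e p q) = pderiv ([:a:]*(p*p*p*p) + [:b:]*(p*p*p*q) + [:c:]*(p*p*q*q) + [:d:]*(p*q*q*q) + [:e:]*(q*q*q*q))"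
    unfolding pform_def qform_def by (rule arg_cong[of _ _ pderiv], Groebner_Basis.algebra)
  also have "\<dots> = [:a:]*pderiv(p*p*p*p) + [:b:]*pderiv(p*p*p*q) + [:c:]*pderiv(p*p*q*q) + [:d:]*pderiv(p*q*q*q) + [:e:]*pderiv(q*q*q*q)"
    by (simp only: pderiv_add c)
  finally show ?thesis unfolding pderiv_mult by Groebner_Basis.algebra
qed

lemma dvd_wronskian_of_pform_eq:
  fixes p q s :: "'k::{alg_closed_field,field_char_0} poly"
  assumes eq: "pform a b c d e p q = g * s^2" and s: "s \<noteq> 0"
    and disc: "qdisc a b c d e \<noteq> 0"
    and cop: "\<And>z. poly p z \<noteq> 0 \<or> poly q z \<noteq> 0"
  shows "s dvd wronskian p q"
proof -
  define DU where "DU = 4*[:a:]*p^3 + 3*[:b:]*p^2*q + 2*[:c:]*p*q^2 + [:d:]*q^3"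
  define DV where "DV = [:b:]*p^3 + 2*[:c:]*p^2*q + 3*[:d:]*p*q^2 + 4*[:e:]*q^3"
  \<comment> \<open>Eliminating with Euler's identity, \<open>s\<close> divides \<open>w\<close> times both partial derivatives of the form,
     which have no common root because the form is nondegenerate.\<close>
  have d: "DU * pderiv p + DV * pderiv q = pderiv g * s^2 + 2 * g * s * pderiv s"
    using arg_cong[OF eq, of pderiv] unfolding pderiv_pform DU_def[symmetric] DV_def[symmetric]
    by (simp add: pderiv_mult power2_eq_square algebra_simps)
  have eu: "p * DU + q * DV = 4 * g * s^2"
    using eq unfolding pform_def qform_def DU_def DV_def by Groebner_Basis.algebra
  have 1: "DU * wronskian p q = s * (q * (pderiv g * s + 2 * g * pderiv s) - 4 * g * s * pderiv q)"
    using d eu unfolding wronskian_def by Groebner_Basis.algebra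
  have 2: "DV * wronskian p q = s * (4 * g * s * pderiv p - p * (pderiv g * s + 2 * g * pderiv s))"
    using d eu unfolding wronskian_def by Groebner_Basis.algebra
  have 3: "poly DU z \<noteq> 0 \<or> poly DV z \<noteq> 0" for z
  proof -
    have "poly DU z = 4*a*poly p z^3 + 3*b*poly p z^2*poly q z + 2*c*poly p z*poly q z^2 + d*poly q z^3"
      "poly DV z = b*poly p z^3 + 2*c*poly p z^2*poly q z + 3*d*poly p z*poly q z^2 + 4*e*poly q z^3"
      by (simp_all add: DU_def DV_def)
    thus ?thesis
      using qdisc_zero_of_critical[of a "poly p z" b "poly q z" c d e] disc cop[of z] by argo
  qed
  show ?thesis
    by (rule dvd_of_dvd_mult_no_common_root[OF s _ _ 3]) (simp_all only: 1 2 dvd_triv_left)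
qed

section \<open>Degrees of Wronskians and of quartic forms in two polynomials\<close>

lemma wronskian_const: "degree p = 0 \<Longrightarrow> degree q = 0 \<Longrightarrow> wronskian p q = 0"
  by (auto simp: wronskian_def elim!: degree_eq_zeroE)

lemma degree_wronskian:
  fixes p q :: "'k::field_char_0 poly"
  assumes "wronskian p q \<noteq> 0"
  shows "degree (wronskian p q) + 1 \<le> degree p + degree q"
proof -
  have "degree p + degree q \<noteq> 0"
    using assms wronskian_const[of p q] by auto
  moreover have "degree (pderiv p * q) \<le> degree p + degree q - 1"
  proof (cases "degree p = 0")
    case True thus ?thesis by (auto elim: degree_eq_zeroE)
  next
    case False
    have "degree (pderiv p * q) \<le> degree (pderiv p) + degree q" by (rule degree_mult_le)
    thus ?thesis using False degree_pderiv[of p] by linarith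
  qed
  moreover have "degree (p * pderiv q) \<le> degree p + degree q - 1"
  proof (cases "degree q = 0")
    case True thus ?thesis by (auto elim: degree_eq_zeroE)
  next
    case False
    have "degree (p * pderiv q) \<le> degree p + degree (pderiv q)" by (rule degree_mult_le)
    thus ?thesis using False degree_pderiv[of q] by linarith
  qed
  ultimately have "degree (wronskian p q) \<le> degree p + degree q - 1"
    unfolding wronskian_def by (intro degree_diff_le)
  thus ?thesis using \<open>degree p + degree q \<noteq> 0\<close> by linarith
qed

text \<open>
  At most one of the four linear factors of the form can drop in degree at \<open>(p, q)\<close>; below, \<open>n\<close> is the
  degree of that factor.
\<close>

lemma degree_pform_less:
  fixes p q :: "'k::field_char_0 poly"
  assumes lt: "degree q < degree p" and q: "q \<noteq> 0" and disc: "qdisc a b c d e \<noteq> 0"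
  shows "pform a b c d e p q \<noteq> 0 \<and> (degree (pform a b c d e p q) = 4 * degree p \<or>
     degree (pform a b c d e p q) = 3 * degree p + degree q)"
proof -
  let ?N = "degree p"
  have p: "p \<noteq> 0" using lt by auto
  define h where "h = [:b:]*p^3 + q * ([:c:]*p^2 + [:d:]*p*q + [:e:]*q^2)"
  have F: "pform a b c d e p q = [:a:] * p^4 + q * h"
    unfolding pform_def qform_def h_def by Groebner_Basis.algebra
  have le: "degree (r * s) \<le> m + n" if "degree r \<le> m" "degree s \<le> n" for r s :: "'k poly" and m n
    using degree_mult_le[of r s] that by linarith
  have pw: "degree (r ^ k) \<le> m * k" if "degree r \<le> m" for r :: "'k poly" and k m
    using degree_power_le[of r k] that by (meson dual_order.trans mult_le_mono1)
  have q': "degree q \<le> ?N - 1" using lt by linarith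
  have "degree ([:c:]*p^2 + [:d:]*p*q + [:e:]*q^2) \<le> 2 * ?N"
  proof (intro degree_add_le)
    show "degree ([:c:]*p^2) \<le> 2 * ?N" using le[of "[:c:]" 0 "p^2" "2 * ?N"] pw[of p ?N 2] by simp
    show "degree ([:d:]*p*q) \<le> 2 * ?N" using le[of "[:d:]*p" ?N q ?N] lt le[of "[:d:]" 0 p ?N] by simp
    show "degree ([:e:]*q^2) \<le> 2 * ?N" using le[of "[:e:]" 0 "q^2" "2 * ?N"] pw[of q ?N 2] lt by simp
  qed
  hence hr: "degree (q * ([:c:]*p^2 + [:d:]*p*q + [:e:]*q^2)) < 3 * ?N"
    using le[OF q', of _ "2 * ?N"] lt by fastforce
  have hb: "degree ([:b:]*p^3) \<le> 3 * ?N"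
    using le[of "[:b:]" 0 "p^3" "3 * ?N"] pw[of p ?N 3] by simp
  have hle: "degree h \<le> 3 * ?N"
    unfolding h_def using hb hr by (intro degree_add_le) auto
  show ?thesis
  proof (cases "a = 0")
    case False
    have d1: "degree ([:a:] * p^4) = 4 * ?N" using False p by (simp add: degree_power_eq)
    have "degree (q * h) < 4 * ?N" using le[OF q' hle] lt by simp
    hence "degree (pform a b c d e p q) = 4 * ?N"
      unfolding F using d1 by (subst degree_add_eq_left) auto
    thus ?thesis using lt by auto
  next
    case True
    \<comment> \<open>With \<open>a = b = 0\<close> the form would have a double root at infinity,
      and its discriminant would vanish.\<close>
    have b: "b \<noteq> 0"
      using disc True by (auto simp: qdisc_def invI_def invJ_def algebra_simps power2_eq_square power3_eq_cube)
    have d1: "degree ([:b:] * p^3) = 3 * ?N" using b p by (simp add: degree_power_eq)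
    have dh: "degree h = 3 * ?N"
      unfolding h_def using d1 hr by (subst degree_add_eq_left) auto
    hence "h \<noteq> 0" using lt by auto
    hence "degree (q * h) = 3 * ?N + degree q" using q dh by (simp add: degree_mult_eq)
    moreover have "q * h \<noteq> 0" using q \<open>h \<noteq> 0\<close> by simp
    ultimately show ?thesis unfolding F using True by simp
  qed
qed

text \<open>Subtracting \<open>m\<close> times \<open>p\<close> cancels the coefficient of
  \<open>q\<close> in degree \<open>degree p\<close>. This substitution is unimodular, so the
  invariants and the Wronskian stay the same and the case of unequal degrees applies.\<close>

lemma degree_pform_of_degree_le:
  fixes p q :: "'k::field_char_0 poly"
  assumes le: "degree q \<le> degree p" and w: "wronskian p q \<noteq> 0" and disc: "qdisc a b c d e \<noteq> 0"
  shows "\<exists>n \<le> degree p. pform a b c d e p q \<noteq> 0 \<and> degree (pform a b c d e p q) = 3 * degree p + n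
     \<and> degree (wronskian p q) + 1 \<le> degree p + n"
proof -
  have p0: "degree p \<noteq> 0"
    using w le wronskian_const[of p q] by auto
  define m where "m = coeff q (degree p) / lead_coeff p"
  define r where "r = q - [:m:] * p"
  have lp: "lead_coeff p \<noteq> 0" using p0 by auto
  have "degree r \<le> degree p" unfolding r_def using le by (intro degree_diff_le) auto
  moreover have "coeff r (degree p) = 0" unfolding r_def m_def using lp by simp
  ultimately have dr: "degree r < degree p"
    using p0 by (metis coeff_0 degree_0 le_neq_implies_less leading_coeff_0_iff)
  have wr: "wronskian p q = wronskian p r"
    unfolding wronskian_def r_def by (simp add: pderiv_diff pderiv_smult algebra_simps)
  have r0: "r \<noteq> 0" using w unfolding wr by (auto simp: wronskian_def)
  have rz: "poly q z = poly r z + m * poly p z" for z by (simp add: r_def)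
  have F: "pform a b c d e p q = pform (qform a b c d e 1 m)
      (b + 2*c*m + 3*d*m^2 + 4*e*m^3) (c + 3*d*m + 6*e*m^2) (d + 4*e*m) e p r"
  proof (rule poly_eq_poly_eq_iff[THEN iffD1], rule ext)
    fix z
    show "poly (pform a b c d e p q) z = poly (pform (qform a b c d e 1 m)
      (b + 2*c*m + 3*d*m^2 + 4*e*m^3) (c + 3*d*m + 6*e*m^2) (d + 4*e*m) e p r) z"
      unfolding poly_pform rz qform_def power_one mult_1_right by Groebner_Basis.algebra
  qed
  have dI: "invI (qform a b c d e 1 m)
      (b + 2*c*m + 3*d*m^2 + 4*e*m^3) (c + 3*d*m + 6*e*m^2) (d + 4*e*m) e = invI a b c d e"
    unfolding qform_def invI_def power_one mult_1_right by Groebner_Basis.algebra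
  have dJ: "invJ (qform a b c d e 1 m)
      (b + 2*c*m + 3*d*m^2 + 4*e*m^3) (c + 3*d*m + 6*e*m^2) (d + 4*e*m) e = invJ a b c d e"
    unfolding qform_def invJ_def power_one mult_1_right by Groebner_Basis.algebra
  have *: "degree (wronskian p q) + 1 \<le> degree p + degree r"
    unfolding wr by (rule degree_wronskian) (use w wr in simp)
  have disc': "qdisc (qform a b c d e 1 m)
      (b + 2*c*m + 3*d*m^2 + 4*e*m^3) (c + 3*d*m + 6*e*m^2) (d + 4*e*m) e \<noteq> 0"
    using disc unfolding qdisc_def dI dJ .
  consider "pform a b c d e p q \<noteq> 0" "degree (pform a b c d e p q) = 3 * degree p + degree p"
    | "pform a b c d e p q \<noteq> 0" "degree (pform a b c d e p q) = 3 * degree p + degree r"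
    using degree_pform_less[OF dr r0 disc'] unfolding F by linarith
  thus ?thesis
  proof cases
    case 1 thus ?thesis using dr * by (intro exI[of _ "degree p"]) auto
  next
    case 2 thus ?thesis using dr * by (intro exI[of _ "degree r"]) auto
  qed
qed

lemma wronskian_swap: "wronskian p q = - wronskian q p"
  by (simp add: wronskian_def)

lemma degree_pform:
  fixes p q :: "'k::field_char_0 poly"
  assumes w: "wronskian p q \<noteq> 0" and disc: "qdisc a b c d e \<noteq> 0"
  defines "N \<equiv> max (degree p) (degree q)"
  shows "\<exists>n \<le> N. pform a b c d e p q \<noteq> 0 \<and> degree (pform a b c d e p q) = 3 * N + n
     \<and> degree (wronskian p q) + 1 \<le> N + n"
proof (cases "degree q \<le> degree p")
  case True
  thus ?thesis using degree_pform_of_degree_le[OF True w disc] by (simp add: N_def max_def)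
next
  case False
  hence N: "N = degree q" by (simp add: N_def)
  have w': "wronskian q p \<noteq> 0" using w wronskian_swap[of p q] by auto
  have "degree (wronskian p q) = degree (wronskian q p)" by (subst wronskian_swap) simp
  thus ?thesis
    using degree_pform_of_degree_le[of p q, OF _ w', of e d c b a] disc False
    unfolding N pform_swap[of a b c d e p q] qdisc_swap[of a b c d e] by auto
qed

text \<open>A genus one curve has no nonconstant rational parametrisation: \<open>s\<close> would
  divide a nonzero Wronskian, so \<open>degree s \<le> N + n - 1\<close>, while
  \<open>2 * degree s = 3 * N + n\<close>, which is impossible for \<open>n \<le> N\<close>.\<close>

lemma wronskian_eq_0_of_pform_square:
  fixes p q s :: "'k::{alg_closed_field,field_char_0} poly"
  assumes eq: "pform a b c d e p q = s^2"
    and disc: "qdisc a b c d e \<noteq> 0"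
    and cop: "\<And>z. poly p z \<noteq> 0 \<or> poly q z \<noteq> 0"
  shows "wronskian p q = 0"
proof (rule ccontr)
  assume w: "wronskian p q \<noteq> 0"
  from degree_pform[OF w disc] obtain n N where n: "n \<le> N" "pform a b c d e p q \<noteq> 0"
      "degree (pform a b c d e p q) = 3 * N + n" "degree (wronskian p q) + 1 \<le> N + n"
    by blast
  have s: "s \<noteq> 0" using n(2) eq by auto
  have "s dvd wronskian p q"
    using dvd_wronskian_of_pform_eq[of a b c d e p q 1 s] eq s disc cop by auto
  hence "degree s \<le> degree (wronskian p q)" using w by (rule dvd_imp_degree_le)
  moreover have "2 * degree s = 3 * N + n" using n(3) eq s by (simp add: degree_power_eq)
  ultimately show False using n by linarith
qed

text \<open>From \<open>p' q = p q'\<close> and coprimality, \<open>p\<close> divides its own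
  derivative, so in characteristic 0 it is constant; the same holds for \<open>q\<close>.\<close>

lemma wronskian_eq_0_imp_degree_0:
  fixes p q :: "'k::{alg_closed_field,field_char_0} poly"
  assumes w: "wronskian p q = 0" and cop: "\<And>z. poly p z \<noteq> 0 \<or> poly q z \<noteq> 0"
  shows "degree p = 0 \<and> degree q = 0"
proof -
  have *: "degree x = 0" if "wronskian x y = 0" "\<And>z. poly x z \<noteq> 0 \<or> poly y z \<noteq> 0" for x y :: "'k poly"
  proof (rule ccontr)
    assume d: "degree x \<noteq> 0"
    have "x dvd pderiv x"
    proof (rule dvd_of_dvd_mult_no_common_root[of x x _ y])
      show "x \<noteq> 0" using d by auto
      have "y * pderiv x = x * pderiv y" using that(1) by (simp add: wronskian_def mult.commute)
      thus "x dvd y * pderiv x" by simp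
    qed (use that in auto)
    moreover have "pderiv x \<noteq> 0" using d by (simp add: pderiv_eq_0_iff)
    ultimately have "degree x \<le> degree (pderiv x)" by (rule dvd_imp_degree_le)
    thus False using d by (simp add: degree_pderiv)
  qed
  have "wronskian q p = 0" using w wronskian_swap[of q p] by simp
  have "poly q z \<noteq> 0 \<or> poly p z \<noteq> 0" for z using cop[of z] by auto
  thus ?thesis using *[of p q, OF w cop] *[of q p, OF \<open>wronskian q p = 0\<close>] by simp
qed

text \<open>Used to clear denominators. A root \<open>z\<close> of \<open>h\<close> that is not a
  root of \<open>r\<close> would be a double root of \<open>g\<close>, because
  \<open>(X - z)^2\<close> is prime to \<open>r^2\<close>; so every linear factor of
  \<open>h\<close> can be cancelled against one of \<open>r\<close>.\<close>

lemma dvd_of_square_dvd_squarefree_mult: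
  fixes g h r :: "'k::alg_closed_field poly"
  assumes g: "\<And>z. \<not> [:-z, 1:]^2 dvd g" and "h \<noteq> 0" "h^2 dvd g * r^2"
  shows "h dvd r"
  using assms(2,3)
proof (induction "degree h" arbitrary: h r)
  case 0
  thus ?case by (metis is_unit_iff_degree unit_imp_dvd)
next
  case (Suc n)
  obtain z where "poly h z = 0"
    using alg_closed_imp_poly_has_root[of h] Suc.hyps(2) by auto
  then obtain h' where h: "h = [:-z, 1:] * h'" by (auto simp: poly_eq_0_iff_dvd)
  have h0: "h' \<noteq> 0" using Suc.prems(1) h by auto
  have deg: "n = degree h'" using Suc.hyps(2) h0 unfolding h by (subst (asm) degree_mult_eq) auto
  have *: "[:-z, 1:]^2 dvd g * r^2"
    using Suc.prems(2) unfolding h by (metis dvd_mult_left power_mult_distrib)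
  have "poly r z = 0"
  proof (rule ccontr)
    assume r: "poly r z \<noteq> 0"
    have "[:-z, 1:]^2 dvd g"
    proof (rule dvd_of_dvd_mult_no_common_root[of _ "r^2" _ "[:-z, 1:]^2"])
      show "[:-z, 1:]^2 dvd r^2 * g" using * by (simp only: mult.commute)
    qed (use r in auto)
    thus False using g by blast
  qed
  then obtain r' where r: "r = [:-z, 1:] * r'" by (auto simp: poly_eq_0_iff_dvd)
  have "[:-z, 1:]^2 * h'^2 dvd [:-z, 1:]^2 * (g * r'^2)"
    using Suc.prems(2) unfolding h r power_mult_distrib by (simp only: mult.left_commute)
  hence "h'^2 dvd g * r'^2" by (subst (asm) dvd_mult_cancel_left) simp
  hence "h' dvd r'" using Suc.hyps(1)[OF deg h0] by blast
  thus ?case unfolding h r by (rule mult_dvd_mono[OF dvd_refl])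
qed

text \<open>A double root \<open>z\<close> makes the form critical at \<open>(z, 1)\<close>: one
  partial derivative there is \<open>g'(z)\<close>, the other is
  \<open>4 g(z) - z g'(z)\<close>.\<close>

lemma cubic_squarefree:
  fixes g :: "'k::field_char_0 poly"
  assumes "degree g \<le> 3" "qdisc 0 (coeff g 3) (coeff g 2) (coeff g 1) (coeff g 0) \<noteq> 0"
  shows "\<not> [:-z, 1:]^2 dvd g"
proof
  assume "[:-z, 1:]^2 dvd g"
  then obtain h where h: "g = [:-z, 1:]^2 * h" by blast
  have z: "poly g z = 0" "poly (pderiv g) z = 0"
    unfolding h by (simp_all only: power2_eq_square pderiv_mult poly_mult poly_add) simp_all
  define g0 g1 g2 g3 where "g0 = coeff g 0" "g1 = coeff g 1" "g2 = coeff g 2" "g3 = coeff g 3"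
  have g: "g = [:g0, g1, g2, g3:]"
    using assms(1) unfolding g0_g1_g2_g3_def
    by (intro poly_eqI) (auto simp: coeff_pCons numeral_2_eq_2 numeral_3_eq_3 coeff_eq_0 split: nat.splits)
  have 0: "g0 + g1*z + g2*z^2 + g3*z^3 = 0" "g1 + 2*g2*z + 3*g3*z^2 = 0"
    using z unfolding g
    by (simp_all add: pderiv_pCons algebra_simps power2_eq_square power3_eq_cube)
  have "qdisc 0 g3 g2 g1 g0 = 0"
  proof (rule qdisc_zero_of_critical_affine[of _ z])
    show "4 * 0 * z^3 + 3 * g3 * z\<^sup>2 + 2 * g2 * z + g1 = 0" using 0(2) by Groebner_Basis.algebra
    show "g3 * z^3 + 2 * g2 * z\<^sup>2 + 3 * g1 * z + 4 * g0 = 0" using 0 by Groebner_Basis.algebra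
  qed
  thus False using assms(2) unfolding g0_g1_g2_g3_def by blast
qed

section \<open>Coverings of degree two\<close>

text \<open>A rational parametrisation of the curve \<open>Phi2 = 0\<close> by the ratio
  \<open>Y / Z\<close>. Over the common denominator \<open>E\<close> it becomes a polynomial
  identity in the numerators \<open>n1\<close> and \<open>n2\<close>.\<close>

lemma Phi2_param:
  fixes Y Z :: "'a::field_char_0"
  assumes "Z \<noteq> 0" "Y \<noteq> 4*Z"
  shows "Phi2 (256*(Y - 3*Z)^3 / (Z^2*(Y - 4*Z))) (16*(Y + 12*Z)^3 / (Z*(Y - 4*Z)^2)) = 0"
proof -
  define E where "E = Z^2*(Y - 4*Z)^2"
  define j1 where "j1 = 256*(Y - 3*Z)^3 / (Z^2*(Y - 4*Z))"
  define j2 where "j2 = 16*(Y + 12*Z)^3 / (Z*(Y - 4*Z)^2)"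
  have E0: "E \<noteq> 0" using assms by (simp add: E_def)
  define n1 where "n1 = 256*(Y - 3*Z)^3*(Y - 4*Z)"
  define n2 where "n2 = 16*(Y + 12*Z)^3*Z"
  have n1: "j1 * E = n1" using assms by (simp add: n1_def j1_def E_def power2_eq_square)
  have n2: "j2 * E = n2" using assms by (simp add: n2_def j2_def E_def power2_eq_square)
  have "n1^3*E + n2^3*E - n1^2*n2^2 + 1488*(n1^2*n2 + n1*n2^2)*E - 162000*(n1^2 + n2^2)*E^2
     + 40773375*n1*n2*E^2 + 8748000000*(n1 + n2)*E^3 - 157464000000000*E^4 = 0"
    unfolding n1_def n2_def E_def by Groebner_Basis.algebra
  hence "Phi2 j1 j2 * E^4 = 0"
    unfolding n1[symmetric] n2[symmetric] Phi2_def by Groebner_Basis.algebra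
  thus ?thesis using E0 by (simp add: j1_def j2_def)
qed

text \<open>A scalar factor of the form, or the square of the determinant of a substitution, enters
  \<open>invI\<close> and \<open>invJ\<close> with exponents 2 and 3 and therefore cancels.\<close>

lemma qj_eqI:
  fixes a :: "'a::field_char_0"
  assumes "invI a b c d e = l^2 * i" "invJ a b c d e = l^3 * j" "l \<noteq> 0"
  shows "qj a b c d e = 6912 * i^3 / (4*i^3 - j^2)"
proof -
  have "qdisc a b c d e = l^6 * (4*i^3 - j^2)"
    unfolding qdisc_def assms by Groebner_Basis.algebra
  moreover have "6912 * invI a b c d e ^ 3 = l^6 * (6912 * i^3)"
    unfolding assms by Groebner_Basis.algebra
  ultimately show ?thesis using assms(3) by (simp add: qj_def)
qed

text \<open>
  The hypotheses say that the two forms are equivalent to \<open>U V (B U\<^sup>2 + C U V + D V\<^sup>2)\<close> and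
  \<open>B U\<^sup>4 + C U\<^sup>2 V\<^sup>2 + D V\<^sup>4\<close>, the first pulling back to \<open>U\<^sup>2 V\<^sup>2\<close> times the second under squaring.
\<close>

lemma Phi2_qj_of_dihedral_form:
  fixes a :: "'a::field_char_0"
  assumes "invI a b c d e = l^2 * (C^2 - 3*B*D)" "invJ a b c d e = l^3 * (9*B*C*D - 2*C^3)" "l \<noteq> 0"
    and "invI a' b' c' d' e' = m^2 * (C^2 + 12*B*D)" "invJ a' b' c' d' e' = m^3 * (72*B*C*D - 2*C^3)" "m \<noteq> 0"
    and disc: "qdisc a b c d e \<noteq> 0"
  shows "Phi2 (qj a b c d e) (qj a' b' c' d' e') = 0"
proof -
  define Y Z where "Y = C^2" and "Z = B*D"
  have "qdisc a b c d e = l^6 * (27 * (Z^2 * (Y - 4*Z)))"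
    unfolding qdisc_def assms Y_def Z_def by Groebner_Basis.algebra
  hence nz: "Z \<noteq> 0" "Y \<noteq> 4*Z" using disc by auto
  have "4*(C^2 - 3*B*D)^3 - (9*B*C*D - 2*C^3)^2 = 27 * (Z^2 * (Y - 4*Z))"
    unfolding Y_def Z_def by Groebner_Basis.algebra
  hence 1: "qj a b c d e = 256*(Y - 3*Z)^3 / (Z^2*(Y - 4*Z))"
    using qj_eqI[OF assms(1-3)] nz by (simp add: Y_def Z_def mult.assoc)
  have "4*(C^2 + 12*B*D)^3 - (72*B*C*D - 2*C^3)^2 = 432 * (Z * (Y - 4*Z)^2)"
    unfolding Y_def Z_def by Groebner_Basis.algebra
  hence 2: "qj a' b' c' d' e' = 16*(Y + 12*Z)^3 / (Z*(Y - 4*Z)^2)"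
    using qj_eqI[OF assms(4-6)] nz by (simp add: Y_def Z_def mult.assoc)
  show ?thesis unfolding 1 2 by (rule Phi2_param) (use nz in auto)
qed

lemma quadratic_double_root:
  fixes u :: "'k::field_char_0 poly"
  assumes "degree u \<le> 2" "poly u z = 0" "poly (pderiv u) z = 0"
  shows "u = [:coeff u 2:] * [:-z, 1:]^2"
proof -
  have u: "u = [:coeff u 0, coeff u 1, coeff u 2:]"
    using assms(1) by (intro poly_eqI) (auto simp: coeff_pCons numeral_2_eq_2 coeff_eq_0 split: nat.splits)
  define u0 u1 u2 where "u0 = coeff u 0" "u1 = coeff u 1" "u2 = coeff u 2"
  have 1: "u0 + u1*z + u2*z^2 = 0"
    using assms(2) by (subst (asm) u) (simp add: u0_u1_u2_def power2_eq_square algebra_simps)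
  have 2: "u1 + 2*u2*z = 0"
    using assms(3) by (subst (asm) u) (simp add: u0_u1_u2_def pderiv_pCons algebra_simps)
  have "u1 = -2*u2*z" using 2 by Groebner_Basis.algebra
  moreover have "u0 = u2*z^2" using 1 2 by Groebner_Basis.algebra
  ultimately show ?thesis
    by (subst u) (simp add: u0_u1_u2_def[symmetric, simplified] power2_eq_square)
qed

lemma wronskian_eq_0_of_proportional:
  fixes p q :: "'k::idom poly"
  assumes "[:x:] * p = [:y:] * q" "x \<noteq> 0 \<or> y \<noteq> 0"
  shows "wronskian p q = 0"
proof -
  have d: "[:x:] * pderiv p = [:y:] * pderiv q"
    using arg_cong[OF assms(1), of pderiv] by (simp add: pderiv_smult)
  have "[:x:] * wronskian p q = 0" "[:y:] * wronskian p q = 0"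
    using assms(1) d unfolding wronskian_def by Groebner_Basis.algebra+
  thus ?thesis using assms(2) by auto
qed

lemma Phi2_qj_of_degree_2:
  fixes p q s g :: "'k::{alg_closed_field,field_char_0} poly"
  assumes eq: "pform a b c d e p q = g * s^2"
    and disc: "qdisc a b c d e \<noteq> 0"
    and cop: "\<And>z. poly p z \<noteq> 0 \<or> poly q z \<noteq> 0"
    and deg: "max (degree p) (degree q) = 2"
    and w: "wronskian p q \<noteq> 0"
    and g: "degree g = 3"
  shows "Phi2 (qj a b c d e) (qj 0 (coeff g 3) (coeff g 2) (coeff g 1) (coeff g 0)) = 0"
proof -
  obtain n where n: "n \<le> 2" "pform a b c d e p q \<noteq> 0" "degree (pform a b c d e p q) = 6 + n"
      "degree (wronskian p q) + 1 \<le> 2 + n"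
    using degree_pform[OF w disc] unfolding deg by auto
  have s: "s \<noteq> 0" using n(2) eq by auto
  \<comment> \<open>By parity \<open>n\<close> is odd, hence 1. Then \<open>s\<close> has degree 2
    and the Wronskian degree at most 2, so the cofactor \<open>h\<close> is constant.\<close>
  have "6 + n = 3 + 2 * degree s"
    using n(2,3) g s unfolding eq by (simp add: degree_mult_eq degree_power_eq)
  hence n1: "n = 1" and ds: "degree s = 2" using n(1) by presburger+
  have "s dvd wronskian p q" by (rule dvd_wronskian_of_pform_eq[OF eq s disc cop])
  then obtain h where h: "wronskian p q = s * h" by blast
  have "degree s + degree h \<le> 2" using n(4) w n1 unfolding h by (simp add: degree_mult_eq)
  hence "degree h = 0" using ds by simp
  then obtain h0 where h0: "h = [:h0:]" by (elim degree_eq_zeroE)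
  obtain al where "poly s al = 0" using alg_closed_imp_poly_has_root[of s] ds by auto
  then obtain s1 where s1: "s = [:-al, 1:] * s1" by (auto simp: poly_eq_0_iff_dvd)
  have s10: "s1 \<noteq> 0" using s s1 by auto
  have ds1: "degree s1 = 1" using ds s10 unfolding s1 by (subst (asm) degree_mult_eq) auto
  obtain be where "poly s1 be = 0" using alg_closed_imp_poly_has_root[of s1] ds1 by auto
  then obtain s2 where s2: "s1 = [:-be, 1:] * s2" by (auto simp: poly_eq_0_iff_dvd)
  have "degree s2 = 0" using ds1 s10 unfolding s2 by (subst (asm) degree_mult_eq) auto
  then obtain sg where sg: "s2 = [:sg:]" by (elim degree_eq_zeroE)
  have sg0: "sg \<noteq> 0" using s10 sg s2 by auto
  define k0 where "k0 = h0 * sg"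
  have wf: "wronskian p q = [:-al, 1:] * [:-be, 1:] * [:k0:]"
    unfolding h h0 s1 s2 sg k0_def by (simp add: algebra_simps)

  \<comment> \<open>The member of the pencil of \<open>p\<close> and \<open>q\<close> that vanishes at \<open>z\<close>; at a root of the Wronskian it
     vanishes doubly.\<close>
  define pencil where "pencil z = [:poly q z:] * p - [:poly p z:] * q" for z
  have pencil_nz: "pencil z \<noteq> 0" for z
    using wronskian_eq_0_of_proportional[of "poly q z" p "poly p z" q] w cop[of z]
    by (auto simp: pencil_def)
  have dp: "degree p \<le> 2" "degree q \<le> 2" using deg by auto
  have pencil: "pencil z = [:coeff (pencil z) 2:] * [:-z, 1:]^2" if "poly (wronskian p q) z = 0" for z
  proof (rule quadratic_double_root)
    show "degree (pencil z) \<le> 2"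
      unfolding pencil_def using dp by (intro degree_diff_le) (auto intro: order.trans[OF degree_smult_le])
    show "poly (pencil z) z = 0" by (simp add: pencil_def)
    show "poly (pderiv (pencil z)) z = 0"
      using that by (simp add: pencil_def wronskian_def pderiv_diff pderiv_smult algebra_simps)
  qed
  define U V where "U = pencil al" and "V = pencil be"
  define c1 c2 where "c1 = coeff U 2" and "c2 = coeff V 2"
  have U: "U = [:c1:] * [:-al, 1:]^2" and V: "V = [:c2:] * [:-be, 1:]^2"
    unfolding U_def V_def c1_def c2_def by (rule pencil, simp only: wf poly_mult, simp)+
  have nz: "U \<noteq> 0" "V \<noteq> 0" unfolding U_def V_def by (rule pencil_nz)+
  have c12: "c1 \<noteq> 0" "c2 \<noteq> 0" using nz U V by auto
  \<comment> \<open>Otherwise the Wronskian would vanish doubly at \<open>al\<close>; but its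
    derivative \<open>p'' q - p q''\<close> takes there the same value as the second derivative of
    \<open>U\<close>, which is \<open>2 * c1\<close>.\<close>
  have ne: "al \<noteq> be"
  proof
    assume "al = be"
    hence "poly (pderiv (wronskian p q)) al = 0" unfolding wf by (simp add: pderiv_mult pderiv_pCons)
    hence "poly (pderiv (pderiv U)) al = 0"
      by (simp add: U_def pencil_def wronskian_def pderiv_diff pderiv_smult pderiv_mult algebra_simps)
    thus False using c12 unfolding U by (simp add: power2_eq_square pderiv_smult pderiv_mult pderiv_pCons)
  qed
  have Uz: "poly U z = c1*(z - al)^2" and Vz: "poly V z = c2*(z - be)^2" for z
    unfolding U V by simp_all
  \<comment> \<open>Up to sign, \<open>dt\<close> is the determinant of the system expressing
    \<open>U\<close> and \<open>V\<close> by \<open>p\<close> and \<open>q\<close>;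
    \<open>rel\<close> is its solution by Cramer's rule.\<close>
  define dt where "dt = poly q al * poly p be - poly p al * poly q be"
  have rel: "[:dt:] * p = [:poly p be:] * U - [:poly p al:] * V"
            "[:dt:] * q = [:poly q be:] * U - [:poly q al:] * V"
    unfolding dt_def U_def V_def pencil_def by (simp_all add: algebra_simps smult_diff_left smult_diff_right)
  have dt: "dt \<noteq> 0"
  proof
    assume "dt = 0"
    hence r: "[:poly p be:] * U = [:poly p al:] * V" "[:poly q be:] * U = [:poly q al:] * V"
      using rel by simp_all
    have "poly V al \<noteq> 0" unfolding Vz using c12 ne by simp
    moreover have "poly U al = 0" unfolding Uz by simp
    ultimately have "poly p al = 0" "poly q al = 0"
      using arg_cong[OF r(1), of "\<lambda>u. poly u al"] arg_cong[OF r(2), of "\<lambda>u. poly u al"] by simp_all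
    thus False using cop[of al] by simp
  qed

  \<comment> \<open>The matrix of the substitution in \<open>rel\<close>; \<open>a'\<close> to
    \<open>e'\<close> are the coefficients of the form in the coordinates \<open>U\<close>,
    \<open>V\<close>. The determinant is \<open>- dt\<close>, but only even powers of it
    occur.\<close>
  define n1 n2 n3 n4 where "n1 = poly p be" "n2 = - poly p al" "n3 = poly q be" "n4 = - poly q al"
  define a' where "a' = qform a b c d e n1 n3"
  define b' where "b' = 4*a*n1^3*n2 + b*(3*n1^2*n2*n3 + n1^3*n4) + c*(2*n1*n2*n3^2 + 2*n1^2*n3*n4) + d*(n2*n3^3 + 3*n1*n3^2*n4) + 4*e*n3^3*n4"
  define c' where "c' = 6*a*n1^2*n2^2 + b*(3*n1*n2^2*n3 + 3*n1^2*n2*n4) + c*(n2^2*n3^2 + 4*n1*n2*n3*n4 + n1^2*n4^2) + d*(3*n2*n3^2*n4 + 3*n1*n3*n4^2) + 6*e*n3^2*n4^2"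
  define d' where "d' = 4*a*n1*n2^3 + b*(n2^3*n3 + 3*n1*n2^2*n4) + c*(2*n2^2*n3*n4 + 2*n1*n2*n4^2) + d*(3*n2*n3*n4^2 + n1*n4^3) + 4*e*n3*n4^3"
  define e' where "e' = qform a b c d e n2 n4"
  have dtn: "dt^2 = (n1*n4 - n2*n3)^2" unfolding dt_def n1_n2_n3_n4_def by Groebner_Basis.algebra
  have sub: "qform a b c d e (n1*u + n2*v) (n3*u + n4*v) = qform a' b' c' d' e' u v" for u v
    unfolding a'_def b'_def c'_def d'_def e'_def by (rule qform_subst)
  have I': "invI a' b' c' d' e' = (dt^2)^2 * invI a b c d e"
    unfolding a'_def b'_def c'_def d'_def e'_def invI_subst dtn by (simp flip: power_mult)
  have J': "invJ a' b' c' d' e' = (dt^2)^3 * invJ a b c d e"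
    unfolding a'_def b'_def c'_def d'_def e'_def invJ_subst dtn by (simp flip: power_mult)
  have id: "qform a' b' c' d' e' (c1*(z - al)^2) (c2*(z - be)^2)
      = dt^4 * sg^2 * poly g z * (z - al)^2 * (z - be)^2" for z
  proof -
    have pz: "dt * poly p z = n1 * poly U z + n2 * poly V z" "dt * poly q z = n3 * poly U z + n4 * poly V z"
      using arg_cong[OF rel(1), of "\<lambda>u. poly u z"] arg_cong[OF rel(2), of "\<lambda>u. poly u z"]
      by (simp_all add: n1_n2_n3_n4_def)
    have "qform a' b' c' d' e' (poly U z) (poly V z) = qform a b c d e (dt * poly p z) (dt * poly q z)"
      unfolding sub[symmetric] pz ..
    also have "\<dots> = dt^4 * qform a b c d e (poly p z) (poly q z)"
      unfolding qform_def by Groebner_Basis.algebra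
    also have "qform a b c d e (poly p z) (poly q z) = poly g z * ((z - al) * ((z - be) * sg))^2"
    proof -
      have "poly s z = (z - al) * ((z - be) * sg)"
        unfolding s1 s2 sg by (simp only: poly_mult) simp
      thus ?thesis using arg_cong[OF eq, of "\<lambda>u. poly u z"] by (simp add: poly_pform)
    qed
    finally show ?thesis unfolding Uz Vz by Groebner_Basis.algebra
  qed
  \<comment> \<open>At \<open>al\<close> both \<open>U\<close> and the right-hand side vanish, which
    leaves only the term in \<open>e'\<close>; at \<open>be\<close> the same happens to
    \<open>a'\<close>. So both branch values are roots of the quartic.\<close>
  have e'0: "e' = 0" using id[of al] c12 ne by (simp add: qform_def)
  have a'0: "a' = 0" using id[of be] c12 ne by (simp add: qform_def)

  \<comment> \<open>With \<open>a' = e' = 0\<close> the form is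
    \<open>U V (b' U^2 + c' U V + d' V^2)\<close>. Inserting the two squares and cancelling
    \<open>(z - al)^2 (z - be)^2\<close> leaves \<open>g\<close> as an even quartic form in
    \<open>z - al\<close> and \<open>z - be\<close>.\<close>
  define B C D where "B = b'*c1^2" and "C = c'*(c1*c2)" and "D = d'*c2^2"
  define m where "m = c1*c2 / (dt^4*sg^2)"
  have m0: "m \<noteq> 0" using c12 dt sg0 by (simp add: m_def)
  define G where "G = [:m:] * ([:B:]*[:-al,1:]^4 + [:C:]*([:-al,1:]^2*[:-be,1:]^2) + [:D:]*[:-be,1:]^4)"
  have "g * ([:-al,1:]^2 * [:-be,1:]^2) = G * ([:-al,1:]^2 * [:-be,1:]^2)"
  proof (rule poly_eq_poly_eq_iff[THEN iffD1], rule ext)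
    fix z
    define K where "K = dt^4*sg^2"
    have K0: "K \<noteq> 0" using dt sg0 by (simp add: K_def)
    have "K * (poly g z * ((z - al)^2*(z - be)^2)) =
      c1*c2*((B*(z-al)^4 + C*((z-al)^2*(z-be)^2) + D*(z-be)^4) * ((z - al)^2*(z - be)^2))"
      using id[of z] unfolding e'0 a'0 B_def C_def D_def K_def qform_def by Groebner_Basis.algebra
    also have "c1*c2 = K * m" using K0 by (simp add: m_def K_def)
    finally have "poly g z * ((z - al)^2*(z - be)^2) =
      m*((B*(z-al)^4 + C*((z-al)^2*(z-be)^2) + D*(z-be)^4) * ((z - al)^2*(z - be)^2))"
      using K0 by (simp only: mult.assoc mult_cancel_left) simp
    thus "poly (g * ([:-al,1:]^2 * [:-be,1:]^2)) z = poly (G * ([:-al,1:]^2 * [:-be,1:]^2)) z"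
      by (simp add: G_def mult.assoc)
  qed
  hence gG: "g = G" by simp
  have Gx: "G = [: m*(B*al^4 + C*al^2*be^2 + D*be^4), m*(-4*B*al^3 - 2*C*(al*be^2 + al^2*be) - 4*D*be^3),
      m*(6*B*al^2 + C*(al^2 + 4*al*be + be^2) + 6*D*be^2), m*(-4*B*al - 2*C*(al+be) - 4*D*be), m*(B+C+D):]"
  proof (rule poly_eq_poly_eq_iff[THEN iffD1], rule ext)
    fix z
    show "poly G z = poly [: m*(B*al^4 + C*al^2*be^2 + D*be^4), m*(-4*B*al^3 - 2*C*(al*be^2 + al^2*be) - 4*D*be^3),
      m*(6*B*al^2 + C*(al^2 + 4*al*be + be^2) + 6*D*be^2), m*(-4*B*al - 2*C*(al+be) - 4*D*be), m*(B+C+D):] z"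
      unfolding G_def poly_mult poly_add poly_power poly_pCons poly_0 by Groebner_Basis.algebra
  qed
  have co: "coeff g 0 = m*(B*al^4 + C*al^2*be^2 + D*be^4)"
     "coeff g 1 = m*(-4*B*al^3 - 2*C*(al*be^2 + al^2*be) - 4*D*be^3)"
     "coeff g 2 = m*(6*B*al^2 + C*(al^2 + 4*al*be + be^2) + 6*D*be^2)"
     "coeff g 3 = m*(-4*B*al - 2*C*(al+be) - 4*D*be)" "coeff g 4 = m*(B+C+D)"
    unfolding gG Gx by (simp_all add: eval_nat_numeral)
  \<comment> \<open>The cubic \<open>g\<close> is a quartic form with leading coefficient 0, so its
    invariants can be computed from \<open>G\<close>.\<close>
  have "coeff g 4 = 0" using g by (simp add: coeff_eq_0)
  hence z0: "m*(B+C+D) = 0" unfolding co .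
  \<comment> \<open>\<open>l\<close> collects the scalar \<open>m\<close> and the determinant
    \<open>al - be\<close> of the substitution, which enters through its square.\<close>
  define l where "l = m*(al - be)^2"
  have l0: "l \<noteq> 0" using m0 ne by (simp add: l_def)
  \<comment> \<open>Returning from \<open>B\<close>, \<open>C\<close>, \<open>D\<close> to
    \<open>b'\<close>, \<open>c'\<close>, \<open>d'\<close> multiplies \<open>C^2\<close> and
    \<open>B*D\<close> by the same factor \<open>gg^2\<close>, so both quartics can be described by
    one triple.\<close>
  define gg where "gg = c1*c2"
  have gg0: "gg \<noteq> 0" using c12 by (simp add: gg_def)
  have BD: "B*D = gg^2*(b'*d')" "C = gg*c'" unfolding B_def C_def D_def gg_def by Groebner_Basis.algebra+
  have Ig: "invI 0 (coeff g 3) (coeff g 2) (coeff g 1) (coeff g 0) = l^2 * (C^2 + 12*B*D)"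
  proof -
    have "invI (m*(B+C+D)) (coeff g 3) (coeff g 2) (coeff g 1) (coeff g 0) = l^2 * (C^2 + 12*B*D)"
      unfolding co invI_def l_def by Groebner_Basis.algebra
    thus ?thesis unfolding z0 .
  qed
  have Jg: "invJ 0 (coeff g 3) (coeff g 2) (coeff g 1) (coeff g 0) = l^3 * (72*B*C*D - 2*C^3)"
  proof -
    have "invJ (m*(B+C+D)) (coeff g 3) (coeff g 2) (coeff g 1) (coeff g 0) = l^3 * (72*B*C*D - 2*C^3)"
      unfolding co invJ_def l_def by Groebner_Basis.algebra
    thus ?thesis unfolding z0 .
  qed
  have I1: "invI a b c d e = (1 / dt^2)^2 * (c'^2 - 3*b'*d')"
    using I' dt unfolding a'0 e'0 by (simp add: invI_def field_simps)
  have J1: "invJ a b c d e = (1 / dt^2)^3 * (9*b'*c'*d' - 2*c'^3)"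
    using J' dt unfolding a'0 e'0 by (simp add: invJ_def field_simps)
  have I2: "l^2 * (C^2 + 12*B*D) = (l*gg)^2 * (c'^2 + 12*b'*d')"
    using BD by Groebner_Basis.algebra
  have J2: "l^3 * (72*B*C*D - 2*C^3) = (l*gg)^3 * (72*b'*c'*d' - 2*c'^3)"
    using BD by Groebner_Basis.algebra
  show ?thesis
    by (rule Phi2_qj_of_dihedral_form[OF I1 J1 _ Ig[unfolded I2] Jg[unfolded J2] _ disc])
       (use dt l0 gg0 in auto)
qed

section \<open>The pair of cubics attached to \<open>s1\<close> and \<open>s2\<close>\<close>

lemma qdisc_cubic:
  fixes s1 s2 :: "'a::field_char_0"
  shows "qdisc 0 1 (-s1) s2 (-1) = - 27 * (27 - 18*s1*s2 - s1^2*s2^2 + 4*s1^3 + 4*s2^3)"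
    and "qdisc 0 1 (-s2) s1 (-1) = - 27 * (27 - 18*s1*s2 - s1^2*s2^2 + 4*s1^3 + 4*s2^3)"
  unfolding qdisc_def invI_def invJ_def by (simp_all add: algebra_simps) Groebner_Basis.algebra+

lemma isog2_of_Phi2:
  fixes s1 s2 :: "'a::field_char_0"
  assumes disc: "27 - 18*s1*s2 - s1^2*s2^2 + 4*s1^3 + 4*s2^3 \<noteq> 0"
    and Phi: "Phi2 (qj 0 1 (-s1) s2 (-1)) (qj 0 1 (-s2) s1 (-1)) = 0"
  shows "isog2_f1 (s1*s2) (s1^3 + s2^3) * isog2_f2 (s1*s2) (s1^3 + s2^3) = 0"
proof -
  define dl where "dl = s1^2*s2^2 + 18*s1*s2 - 4*s1^3 - 4*s2^3 - 27"
  have neg: "27 - 18*s1*s2 - s1^2*s2^2 + 4*s1^3 + 4*s2^3 = - dl"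
    unfolding dl_def by Groebner_Basis.algebra
  have dl0: "dl \<noteq> 0" using disc unfolding neg by simp
  have d: "qdisc 0 1 (-s1) s2 (-1) = 27 * dl" "qdisc 0 1 (-s2) s1 (-1) = 27 * dl"
    unfolding qdisc_cubic(1)[of s1 s2] qdisc_cubic(2)[of s2 s1] neg by simp_all
  \<comment> \<open>Here 256 = 6912 / 27, as both cubics have \<open>qdisc\<close> equal to
    \<open>27 * dl\<close>.\<close>
  define n1 n2 where "n1 = 256 * (s1^2 - 3*s2)^3" "n2 = 256 * (s2^2 - 3*s1)^3"
  define j1 j2 where "j1 = n1 / dl" "j2 = n2 / dl"
  have j: "qj 0 1 (-s1) s2 (-1) = j1" "qj 0 1 (-s2) s1 (-1) = j2"
    unfolding qj_def d j1_j2_def n1_n2_def using dl0 by (simp_all add: invI_def)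
  have jn: "n1 = j1 * dl" "n2 = j2 * dl" using dl0 by (simp_all add: j1_j2_def)
  define u v where "u = s1*s2" "v = s1^3 + s2^3"
  \<comment> \<open>\<open>B\<close> is the product of \<open>s1^2 - 3*s2\<close> and
    \<open>s2^2 - 3*s1\<close>, and \<open>A\<close> the sum of their cubes, both rewritten in
    \<open>u\<close> and \<open>v\<close>.\<close>
  define A B where "A = v^2 - 2*u^3 - 9*u*v + 54*u^2 - 27*v" "B = u^2 - 3*v + 9*u"
  have A: "256 * A = n1 + n2" unfolding A_B_def u_v_def n1_n2_def by Groebner_Basis.algebra
  have B: "65536 * B^3 = n1 * n2" unfolding A_B_def u_v_def n1_n2_def by Groebner_Basis.algebra
  have D: "dl = u^2 + 18*u - 4*v - 27" unfolding dl_def u_v_def by Groebner_Basis.algebra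
  have "- 4096 * (isog2_f1 u v * isog2_f2 u v) = Phi2 j1 j2 * dl^4"
    unfolding Phi2_isog2_uv[OF A_B_def D, symmetric] A B jn Phi2_def by Groebner_Basis.algebra
  also have "\<dots> = 0" using Phi unfolding j by simp
  finally show ?thesis unfolding u_v_def by simp
qed

section \<open>Function fields\<close>

locale field_embedding =
  fixes emb :: "'k::{alg_closed_field, field_char_0} \<Rightarrow> 'a::field"
  assumes emb_add: "emb (c + d) = emb c + emb d"
    and emb_mult: "emb (c * d) = emb c * emb d"
    and emb_1: "emb 1 = 1"
begin

lemma emb_0: "emb 0 = 0"
  using emb_add[of 0 0] by (metis add.right_neutral add_left_cancel)

lemma emb_uminus: "emb (- c) = - emb c"
  using emb_add[of c "-c"] by (simp add: emb_0 eq_neg_iff_add_eq_0 add.commute)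

lemma emb_diff: "emb (c - d) = emb c - emb d"
  using emb_add[of c "-d"] by (simp add: emb_uminus)

lemma emb_power: "emb (c ^ n) = emb c ^ n"
  by (induction n) (simp_all add: emb_1 emb_mult)

lemma emb_numeral: "emb (numeral n) = numeral n"
  by (induction n) (simp_all only: numeral.simps emb_1 emb_add)

lemma emb_eq_0_iff: "emb c = 0 \<longleftrightarrow> c = 0"
proof
  assume "emb c = 0"
  hence "c \<noteq> 0 \<Longrightarrow> False" using emb_mult[of c "inverse c"] by (simp add: emb_1)
  thus "c = 0" by blast
qed (simp add: emb_0)

lemma emb_eq_iff: "emb c = emb d \<longleftrightarrow> c = d"
  using emb_eq_0_iff[of "c - d"] by (simp add: emb_diff)

lemma emb_inverse: "emb (inverse c) = inverse (emb c)"
  by (metis emb_0 emb_1 emb_mult inverse_unique inverse_zero right_inverse)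

lemmas emb_simps = emb_0 emb_1 emb_add emb_mult emb_uminus emb_diff emb_power emb_numeral

text \<open>Characteristic 0 passes from \<open>'k\<close> to the ambient field because
  \<open>emb\<close> is injective.\<close>

lemma numeral_neq_0: "(numeral n :: 'a) \<noteq> 0"
  using emb_eq_0_iff[of "numeral n"] by (simp add: emb_numeral)

lemma emb_qform: "emb (qform a b c d e u v) = qform (emb a) (emb b) (emb c) (emb d) (emb e) (emb u) (emb v)"
  by (simp add: qform_def emb_simps)

text \<open>\<open>c\<close> is a square in the algebraically closed field \<open>'k\<close>, and a
  field element has at most two square roots.\<close>

lemma sqrt_in_range_emb:
  assumes "x^2 = emb c" shows "x \<in> range emb"
proof -
  obtain d where "poly [:-c, 0, 1:] d = 0"
    using alg_closed_imp_poly_has_root[of "[:-c, 0, 1:]"] by auto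
  hence "c = d^2" by (simp add: power2_eq_square)
  hence "x^2 = emb d ^ 2" using assms by (simp add: emb_power)
  hence "x = emb d \<or> x = emb (- d)" by (simp add: power2_eq_iff emb_uminus)
  thus ?thesis by blast
qed

section \<open>Polynomial evaluation and intermediate fields\<close>

definition ev :: "'k poly \<Rightarrow> 'a \<Rightarrow> 'a" where
  "ev p t = poly (map_poly emb p) t"

lemma ev_0: "ev 0 t = 0"
  by (simp add: ev_def)

lemma ev_pCons: "ev (pCons c p) t = emb c + t * ev p t"
  by (simp add: ev_def map_poly_pCons emb_0)

lemma ev_add: "ev (p + q) t = ev p t + ev q t"
proof -
  have "map_poly emb (p + q) = map_poly emb p + map_poly emb q"
    by (intro poly_eqI) (simp add: coeff_map_poly emb_0 emb_add)
  thus ?thesis by (simp add: ev_def)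
qed

lemma ev_smult: "ev (smult c p) t = emb c * ev p t"
proof -
  have "map_poly emb (smult c p) = smult (emb c) (map_poly emb p)"
    by (intro poly_eqI) (simp add: coeff_map_poly emb_0 emb_mult)
  thus ?thesis by (simp add: ev_def)
qed

lemma ev_mult: "ev (p * q) t = ev p t * ev q t"
  by (induction p) (simp_all add: ev_0 ev_pCons ev_add ev_smult algebra_simps emb_0)

lemma ev_1: "ev 1 t = 1"
  by (simp add: one_pCons ev_pCons ev_0 emb_1)

lemma ev_uminus: "ev (- p) t = - ev p t"
  using ev_smult[of "-1" p t] by (simp add: emb_uminus emb_1)

lemma ev_diff: "ev (p - q) t = ev p t - ev q t"
  using ev_add[of p "-q"] by (simp add: ev_uminus)

lemma ev_power: "ev (p ^ n) t = ev p t ^ n"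
  by (induction n) (simp_all add: ev_1 ev_mult)

lemmas ev_simps = ev_0 ev_1 ev_pCons ev_add ev_mult ev_uminus ev_diff ev_power ev_smult

lemma ev_pform: "ev (pform a b c d e p q) t = qform (emb a) (emb b) (emb c) (emb d) (emb e) (ev p t) (ev q t)"
  by (simp add: pform_def qform_def ev_simps)

text \<open>The intermediate fields over the image of \<open>emb\<close>. Closure under
  \<open>inverse\<close> can include 0 because \<open>inverse 0 = 0\<close>.\<close>

definition kfield :: "'a set \<Rightarrow> bool" where
  "kfield S \<longleftrightarrow> range emb \<subseteq> S \<and> (\<forall>x\<in>S. \<forall>y\<in>S. x + y \<in> S \<and> x * y \<in> S) \<and> (\<forall>x\<in>S. - x \<in> S \<and> inverse x \<in> S)"

lemma kfieldD:
  assumes "kfield S"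
  shows "emb c \<in> S" "0 \<in> S" "1 \<in> S" "numeral n \<in> S"
    "x \<in> S \<Longrightarrow> y \<in> S \<Longrightarrow> x + y \<in> S"
    "x \<in> S \<Longrightarrow> y \<in> S \<Longrightarrow> x * y \<in> S"
    "x \<in> S \<Longrightarrow> y \<in> S \<Longrightarrow> x - y \<in> S"
    "x \<in> S \<Longrightarrow> y \<in> S \<Longrightarrow> x / y \<in> S"
    "x \<in> S \<Longrightarrow> - x \<in> S"
    "x \<in> S \<Longrightarrow> inverse x \<in> S"
    "x \<in> S \<Longrightarrow> x ^ i \<in> S"
proof -
  have e: "emb c \<in> S" for c using assms by (auto simp: kfield_def)
  show "emb c \<in> S" by (rule e)
  show "0 \<in> S" "1 \<in> S" "numeral n \<in> S" using e[of 0] e[of 1] e[of "numeral n"] by (simp_all add: emb_simps)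
  show "x \<in> S \<Longrightarrow> y \<in> S \<Longrightarrow> x + y \<in> S" "x \<in> S \<Longrightarrow> y \<in> S \<Longrightarrow> x * y \<in> S" "x \<in> S \<Longrightarrow> - x \<in> S"
    "x \<in> S \<Longrightarrow> inverse x \<in> S" using assms by (auto simp: kfield_def)
  show "x \<in> S \<Longrightarrow> y \<in> S \<Longrightarrow> x - y \<in> S"
    using assms unfolding kfield_def by (metis add_uminus_conv_diff)
  show "x \<in> S \<Longrightarrow> y \<in> S \<Longrightarrow> x / y \<in> S"
    using assms unfolding kfield_def by (metis divide_inverse)
  show "x ^ i \<in> S" if "x \<in> S"
    using that \<open>1 \<in> S\<close> assms by (induction i) (auto simp: kfield_def)
qed

lemma kfield_range_emb: "kfield (range emb)"
  unfolding kfield_def by (auto simp flip: emb_simps(3-5) emb_inverse)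

lemma ev_in_kfield: "kfield S \<Longrightarrow> t \<in> S \<Longrightarrow> ev p t \<in> S"
  by (induction p) (simp_all add: ev_simps kfieldD)

text \<open>The field \<open>k(t)\<close>, kept as explicit quotients so that numerators and
  denominators can be extracted.\<close>

definition rat :: "'a \<Rightarrow> 'a set" where
  "rat t = {ev p t / ev q t | p q. ev q t \<noteq> 0}"

lemma ratI: "ev q t \<noteq> 0 \<Longrightarrow> ev p t / ev q t \<in> rat t"
  by (auto simp: rat_def)

lemma ratE:
  assumes "x \<in> rat t"
  obtains p q where "ev q t \<noteq> 0" "x = ev p t / ev q t"
  using assms by (auto simp: rat_def)

lemma ev_in_rat: "ev p t \<in> rat t"
  using ratI[of 1 t p] by (simp add: ev_1)

lemma kfield_rat: "kfield (rat t)"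
  unfolding kfield_def
proof (intro conjI ballI)
  show "range emb \<subseteq> rat t"
  proof
    fix x assume "x \<in> range emb"
    then obtain c where "x = ev [:c:] t" by (auto simp: ev_simps)
    thus "x \<in> rat t" using ev_in_rat by simp
  qed
next
  fix x y assume "x \<in> rat t" "y \<in> rat t"
  then obtain p q r s where x: "ev q t \<noteq> 0" "x = ev p t / ev q t" and y: "ev s t \<noteq> 0" "y = ev r t / ev s t"
    by (elim ratE) blast
  have "x + y = ev (p * s + r * q) t / ev (q * s) t" using x y by (simp add: ev_simps add_frac_eq)
  thus "x + y \<in> rat t" using x y ratI[of "q * s" t] by (simp add: ev_mult)
  have "x * y = ev (p * r) t / ev (q * s) t" using x y by (simp add: ev_simps)
  thus "x * y \<in> rat t" using x y ratI[of "q * s" t "p * r"] by (simp add: ev_mult)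
next
  fix x assume "x \<in> rat t"
  then obtain p q where x: "ev q t \<noteq> 0" "x = ev p t / ev q t" by (elim ratE)
  have "- x = ev (- p) t / ev q t" using x by (simp add: ev_simps)
  thus "- x \<in> rat t" using x ratI[of q t] by simp
  show "inverse x \<in> rat t"
  proof (cases "ev p t = 0")
    case True thus ?thesis using x ev_in_rat[of 0 t] by (simp add: ev_0)
  next
    case False thus ?thesis using x ratI[of p t q] by simp
  qed
qed

lemma in_rat: "t \<in> rat t"
  using ev_in_rat[of "[:0, 1:]" t] by (simp add: ev_simps emb_simps)

lemma rat_subset: "kfield S \<Longrightarrow> t \<in> S \<Longrightarrow> rat t \<subseteq> S"
  by (auto simp: rat_def intro!: kfieldD ev_in_kfield)

text \<open>The field \<open>k(t, w)\<close> as soon as \<open>w^2\<close> lies in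
  \<open>k(t)\<close>; components along \<open>1\<close> and \<open>w\<close> are unique only when
  \<open>w\<close> is not in \<open>k(t)\<close>.\<close>

definition quad :: "'a \<Rightarrow> 'a \<Rightarrow> 'a set" where
  "quad t w = {x + y * w | x y. x \<in> rat t \<and> y \<in> rat t}"

lemma quadI: "x \<in> rat t \<Longrightarrow> y \<in> rat t \<Longrightarrow> x + y * w \<in> quad t w"
  by (auto simp: quad_def)

lemma quadE:
  assumes "z \<in> quad t w"
  obtains x y where "x \<in> rat t" "y \<in> rat t" "z = x + y * w"
  using assms by (auto simp: quad_def)

lemma rat_subset_quad: "rat t \<subseteq> quad t w"
  using quadI[of _ t 0 w] kfieldD(2)[OF kfield_rat] by fastforce

lemma in_quad: "t \<in> quad t w" "w \<in> quad t w"
  using rat_subset_quad[of t w] in_rat[of t] quadI[of 0 t 1 w] kfieldD[OF kfield_rat[of t]] by auto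

lemma quad_subset: "kfield S \<Longrightarrow> t \<in> S \<Longrightarrow> w \<in> S \<Longrightarrow> quad t w \<subseteq> S"
  using rat_subset[of S t] by (auto simp: quad_def intro!: kfieldD(5,6))

lemma kfield_quad:
  assumes w: "w^2 \<in> rat t"
  shows "kfield (quad t w)"
  unfolding kfield_def
proof (intro conjI ballI)
  note D = kfieldD[OF kfield_rat[of t]]
  show "range emb \<subseteq> quad t w" using rat_subset_quad[of t w] D(1) by blast
  {
    fix z z' assume "z \<in> quad t w" "z' \<in> quad t w"
    then obtain x y x' y' where z: "x \<in> rat t" "y \<in> rat t" "z = x + y * w"
      and z': "x' \<in> rat t" "y' \<in> rat t" "z' = x' + y' * w" by (elim quadE) blast
    have s: "z + z' = (x + x') + (y + y') * w" using z z' by (simp add: algebra_simps)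
    show "z + z' \<in> quad t w" unfolding s by (intro quadI D z z')
    have p: "z * z' = (x * x' + y * y' * w^2) + (x * y' + y * x') * w"
      using z z' by (simp add: algebra_simps power2_eq_square)
    show "z * z' \<in> quad t w" unfolding p by (intro quadI D z z' w)
  }
  fix z assume "z \<in> quad t w"
  then obtain x y where z: "x \<in> rat t" "y \<in> rat t" "z = x + y * w" by (elim quadE)
  have m: "- z = (- x) + (- y) * w" using z by simp
  show "- z \<in> quad t w" unfolding m by (intro quadI D z)
  show "inverse z \<in> quad t w"
  proof (cases "x - y * w = 0")
    \<comment> \<open>If the conjugate \<open>x - y * w\<close> vanishes, dividing by the norm gives
      nothing, but then \<open>z = 2 * x\<close> already lies in \<open>k(t)\<close>.\<close>
    case True
    hence i: "inverse z = inverse (2 * x)" using z by simp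
    have "inverse z \<in> rat t" unfolding i by (intro D z)
    thus ?thesis using rat_subset_quad by blast
  next
    case False
    define n where "n = x^2 - y^2 * w^2"
    have n: "n = z * (x - y * w)" using z by (simp add: n_def algebra_simps power2_eq_square)
    have nr: "n \<in> rat t" unfolding n_def using z w by (auto intro!: D)
    have i: "inverse z = x / n + (- y / n) * w"
    proof (cases "z = 0")
      case True thus ?thesis unfolding n by simp
    next
      case z0: False
      have "inverse z = (x - y * w) / n" unfolding n using False z0 by (simp add: field_simps)
      thus ?thesis by (simp add: diff_divide_distrib)
    qed
    show ?thesis unfolding i by (intro quadI D z nr)
  qed
qed

section \<open>Transcendental generators and points over \<open>k(t)\<close>\<close>

definition trans_elt :: "'a \<Rightarrow> bool" where
  "trans_elt t \<longleftrightarrow> (\<forall>p. ev p t = 0 \<longrightarrow> p = 0)"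

lemma ev_inject: "trans_elt t \<Longrightarrow> ev p t = ev q t \<longleftrightarrow> p = q"
  unfolding trans_elt_def by (metis ev_diff eq_iff_diff_eq_0)

text \<open>A representation with denominator of least degree is reduced, since a common root would
  allow a linear factor to be cancelled.\<close>

lemma rat_coprimeE:
  assumes t: "trans_elt t" and x: "x \<in> rat t"
  obtains p q where "q \<noteq> 0" "x = ev p t / ev q t" "\<And>z. poly p z \<noteq> 0 \<or> poly q z \<noteq> 0"
proof -
  have "\<exists>n p q. q \<noteq> 0 \<and> x = ev p t / ev q t \<and> degree q = n"
    using x by (elim ratE) (metis ev_0)
  then obtain n where n: "\<exists>p q. q \<noteq> 0 \<and> x = ev p t / ev q t \<and> degree q = n"
    and min: "\<And>m. m < n \<Longrightarrow> \<not> (\<exists>p q. q \<noteq> 0 \<and> x = ev p t / ev q t \<and> degree q = m)"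
    using exists_least_iff[of "\<lambda>n. \<exists>p q. q \<noteq> 0 \<and> x = ev p t / ev q t \<and> degree q = n"] by auto
  from n obtain p q where pq: "q \<noteq> 0" "x = ev p t / ev q t" "degree q = n" by blast
  have "poly p z \<noteq> 0 \<or> poly q z \<noteq> 0" for z
  proof (rule ccontr)
    assume "\<not> ?thesis"
    hence "[:-z, 1:] dvd p" "[:-z, 1:] dvd q" by (auto simp: poly_eq_0_iff_dvd)
    then obtain p' q' where p': "p = [:-z, 1:] * p'" and q': "q = [:-z, 1:] * q'"
      by (elim dvdE)
    have q0: "q' \<noteq> 0" using pq(1) q' by auto
    have "ev [:-z, 1:] t \<noteq> 0" using t unfolding trans_elt_def by (metis pCons_eq_0_iff zero_neq_one)
    hence "x = ev p' t / ev q' t" using pq(2) unfolding p' q' ev_mult by simp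
    moreover have "degree q' < n" using pq(3) q0 unfolding q' by (subst (asm) degree_mult_eq) auto
    ultimately show False using min q0 by blast
  qed
  thus ?thesis using pq that by blast
qed

text \<open>With \<open>y = r / h\<close>, clearing denominators gives
  \<open>pform a b c d e p q * h^2 = g * (q^2 * r)^2\<close>. As \<open>g\<close> is squarefree,
  \<open>h\<close> divides \<open>q^2 * r\<close>, and \<open>s\<close> is the quotient.\<close>

lemma pform_eq_of_rat_point:
  assumes t: "trans_elt t" and g: "\<And>z. \<not> [:-z, 1:]^2 dvd g"
    and x: "q \<noteq> 0" "x = ev p t / ev q t" and y: "y \<in> rat t"
    and eq: "qform (emb a) (emb b) (emb c) (emb d) (emb e) x 1 = ev g t * y^2"
  obtains s where "pform a b c d e p q = g * s^2"
proof -
  obtain r h where h: "ev h t \<noteq> 0" "y = ev r t / ev h t" using y by (elim ratE)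
  have q0: "ev q t \<noteq> 0" using t x(1) by (auto simp: trans_elt_def)
  have h0: "h \<noteq> 0" using h(1) by (auto simp: ev_0)
  have "ev (pform a b c d e p q) t = ev q t ^ 4 * qform (emb a) (emb b) (emb c) (emb d) (emb e) x 1"
  proof -
    have "ev p t = x * ev q t" using q0 x(2) by simp
    thus ?thesis by (simp add: ev_pform qform_def algebra_simps power2_eq_square eval_nat_numeral)
  qed
  also have "\<dots> * ev h t ^ 2 = ev g t * (ev q t ^ 2 * ev r t)^2"
    using h(1) unfolding eq h(2) by (simp add: power_divide power_mult_distrib flip: power_mult)
  finally have "ev (pform a b c d e p q * h^2) t = ev (g * (q^2 * r)^2) t" by (simp add: ev_simps)
  hence *: "pform a b c d e p q * h^2 = g * (q^2 * r)^2" using ev_inject[OF t] by simp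
  hence "h^2 dvd g * (q^2 * r)^2" by (metis dvd_triv_right)
  then obtain s where s: "q^2 * r = h * s"
    using dvd_of_square_dvd_squarefree_mult[OF g h0] by blast
  have "pform a b c d e p q * h^2 = g * s^2 * h^2" using * unfolding s by (simp add: power_mult_distrib algebra_simps)
  hence "pform a b c d e p q = g * s^2" using h0 by simp
  thus ?thesis by (rule that)
qed

text \<open>The case \<open>g = 1\<close>: the Wronskian of numerator and denominator of
  \<open>x\<close> vanishes, so both are constant.\<close>

lemma rat_point_const:
  assumes t: "trans_elt t" and disc: "qdisc a b c d e \<noteq> 0" and x: "x \<in> rat t" and y: "y \<in> rat t"
    and eq: "qform (emb a) (emb b) (emb c) (emb d) (emb e) x 1 = y^2"
  shows "x \<in> range emb"
proof -
  obtain p q where pq: "q \<noteq> 0" "x = ev p t / ev q t" "\<And>z. poly p z \<noteq> 0 \<or> poly q z \<noteq> 0"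
    using rat_coprimeE[OF t x] by blast
  have "\<not> [:-z, 1:]^2 dvd (1 :: 'k poly)" for z
    by (metis dvd_mult_left is_unit_pCons_iff power2_eq_square pCons_eq_0_iff zero_neq_one)
  then obtain s where "pform a b c d e p q = 1 * s^2"
    using pform_eq_of_rat_point[OF t _ pq(1,2) y, of 1 a b c d e] eq by (auto simp: ev_1)
  hence "wronskian p q = 0" using wronskian_eq_0_of_pform_square[OF _ disc pq(3)] by simp
  hence "degree p = 0" "degree q = 0" using wronskian_eq_0_imp_degree_0 pq(3) by blast+
  then obtain c d where "p = [:c:]" "q = [:d:]" by (metis degree_eq_zeroE)
  hence "x = emb (c * inverse d)" using pq(2) by (simp add: ev_simps emb_mult emb_inverse divide_inverse)
  thus ?thesis by blast
qed

text \<open>Otherwise \<open>p^2 = g * q^2\<close> with sides of different degree parity.\<close>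

lemma not_rat_of_odd_degree:
  assumes t: "trans_elt t" and w: "w^2 = ev g t" and g: "odd (degree g)"
  shows "w \<notin> rat t"
proof
  assume "w \<in> rat t"
  then obtain p q where q: "ev q t \<noteq> 0" "w = ev p t / ev q t" by (elim ratE)
  have "ev (p^2) t = ev (g * q^2) t" using w q by (simp add: ev_simps power_divide field_simps)
  hence *: "p^2 = g * q^2" using ev_inject[OF t] by blast
  have "q \<noteq> 0" "g \<noteq> 0" using q g by (auto simp: ev_0)
  hence "degree (g * q^2) = degree g + 2 * degree q" "p \<noteq> 0"
    using * by (auto simp: degree_mult_eq degree_power_eq)
  hence "2 * degree p = degree g + 2 * degree q" unfolding *[symmetric] by (simp add: degree_power_eq)
  thus False using g by presburger
qed

section \<open>The degree of \<open>k(t)\<close> over \<open>k(m)\<close>\<close>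

lemma rat_inverse_subset: "rat m \<subseteq> rat (inverse m)"
  using rat_subset[OF kfield_rat, of m "inverse m"] kfieldD(10)[OF kfield_rat in_rat, of "inverse m"]
  by simp

text \<open>Stated for all large exponents so that several polynomials in \<open>m\<close> can be
  cleared by one common power.\<close>

lemma ev_mult_denom_power:
  assumes m: "m = ev p t / ev q t" "ev q t \<noteq> 0"
  shows "\<exists>N. \<forall>n\<ge>N. \<exists>h. ev r m * ev q t ^ n = ev h t"
proof (induction r)
  case 0
  show ?case by (rule exI[of _ 0]) (auto simp: ev_0 intro: exI[of _ 0])
next
  case (pCons c r)
  then obtain N where N: "\<And>n. n \<ge> N \<Longrightarrow> \<exists>h. ev r m * ev q t ^ n = ev h t" by blast
  have "\<exists>h. ev (pCons c r) m * ev q t ^ n = ev h t" if n: "n \<ge> Suc N" for n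
  proof -
    obtain n' where n': "n = Suc n'" "n' \<ge> N" using n by (cases n) auto
    obtain h where h: "ev r m * ev q t ^ n' = ev h t" using N[OF n'(2)] by blast
    have "ev (pCons c r) m * ev q t ^ n = emb c * ev q t ^ n + (m * ev q t) * (ev r m * ev q t ^ n')"
      by (simp add: ev_pCons n' algebra_simps)
    also have "\<dots> = ev (smult c (q ^ n) + p * h) t"
      using m unfolding h by (simp add: ev_simps)
    finally show ?thesis by blast
  qed
  thus ?case by blast
qed

text \<open>The part of \<open>[k(t) : k(m)] \<ge> degree p\<close> that is relevant here, by
  descent: a relation with polynomial coefficients in \<open>m\<close> is divisible by
  \<open>m\<close>, so only the zero relation survives.\<close>

lemma quadratic_relation_degree:
  assumes t: "trans_elt t" and m: "m = ev p t / ev q t" "q \<noteq> 0" "p \<noteq> 0"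
    and cop: "\<And>z. poly p z \<noteq> 0 \<or> poly q z \<noteq> 0"
    and deg: "degree p > 2"
    and rel: "ev r0 m + ev r1 m * t + ev r2 m * t^2 = 0"
  shows "r0 = 0 \<and> r1 = 0 \<and> r2 = 0"
  using rel
proof (induction "degree r0 + degree r1 + degree r2" arbitrary: r0 r1 r2 rule: less_induct)
  case less
  have q0: "ev q t \<noteq> 0" and p0: "ev p t \<noteq> 0" using t m by (auto simp: trans_elt_def)
  obtain c0 r0' where r0: "r0 = pCons c0 r0'" by (cases r0)
  obtain c1 r1' where r1: "r1 = pCons c1 r1'" by (cases r1)
  obtain c2 r2' where r2: "r2 = pCons c2 r2'" by (cases r2)
  obtain N0 where N0: "\<And>n. n \<ge> N0 \<Longrightarrow> \<exists>h. ev r0' m * ev q t ^ n = ev h t"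
    using ev_mult_denom_power[OF m(1) q0, of r0'] by blast
  obtain N1 where N1: "\<And>n. n \<ge> N1 \<Longrightarrow> \<exists>h. ev r1' m * ev q t ^ n = ev h t"
    using ev_mult_denom_power[OF m(1) q0, of r1'] by blast
  obtain N2 where N2: "\<And>n. n \<ge> N2 \<Longrightarrow> \<exists>h. ev r2' m * ev q t ^ n = ev h t"
    using ev_mult_denom_power[OF m(1) q0, of r2'] by blast
  define n where "n = max N0 (max N1 N2)"
  have n: "n \<ge> N0" "n \<ge> N1" "n \<ge> N2" by (auto simp: n_def)
  obtain h0 h1 h2 where h: "ev r0' m * ev q t ^ n = ev h0 t"
    "ev r1' m * ev q t ^ n = ev h1 t" "ev r2' m * ev q t ^ n = ev h2 t"
    using N0[OF n(1)] N1[OF n(2)] N2[OF n(3)] by blast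
  have mq: "m * ev q t = ev p t" using m q0 by simp
  \<comment> \<open>Clearing denominators, \<open>p\<close> divides the quadratic formed by the constant terms of the
     \<open>ri\<close>, which is therefore zero; then divide the relation by \<open>m\<close>.\<close>
  have "0 = (ev r0 m + ev r1 m * t + ev r2 m * t^2) * (ev q t * ev q t ^ n)" using less.prems by simp
  also have "\<dots> = ev [:c0, c1, c2:] t * (ev q t * ev q t ^ n) + (m * ev q t) *
    (ev r0' m * ev q t ^ n + (ev r1' m * ev q t ^ n) * t + (ev r2' m * ev q t ^ n) * t^2)"
    by (simp add: r0 r1 r2 ev_simps algebra_simps power2_eq_square)
  also have "\<dots> = ev ([:c0, c1, c2:] * q ^ Suc n + p * (h0 + h1 * [:0, 1:] + h2 * [:0, 1:]^2)) t"
    unfolding mq h by (simp add: ev_simps emb_simps power2_eq_square algebra_simps)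
  finally have "[:c0, c1, c2:] * q ^ Suc n + p * (h0 + h1 * [:0, 1:] + h2 * [:0, 1:]^2) = 0"
    using t unfolding trans_elt_def by simp
  hence "q ^ Suc n * [:c0, c1, c2:] = p * (- (h0 + h1 * [:0, 1:] + h2 * [:0, 1:]^2))"
    unfolding mult_minus_right eq_neg_iff_add_eq_0 by (simp only: mult.commute)
  hence pd: "p dvd q ^ Suc n * [:c0, c1, c2:]" by (rule dvdI)
  have dvd: "p dvd [:c0, c1, c2:]"
  proof (rule dvd_of_dvd_mult_no_common_root[OF m(3) _ pd])
    show "p dvd p * [:c0, c1, c2:]" by (rule dvd_triv_left)
    show "poly p z \<noteq> 0 \<or> poly (q ^ Suc n) z \<noteq> 0" for z using cop[of z] by auto
  qed
  have "degree [:c0, c1, c2:] < degree p" using deg by (simp add: degree_pCons_eq_if)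
  hence "[:c0, c1, c2:] = 0" using dvd_imp_degree_le[OF dvd] by linarith
  hence c: "c0 = 0" "c1 = 0" "c2 = 0" by simp_all
  have "m * (ev r0' m + ev r1' m * t + ev r2' m * t^2) = 0"
    using less.prems by (simp add: r0 r1 r2 c ev_simps emb_0 algebra_simps)
  moreover have "m \<noteq> 0" using m q0 p0 by simp
  ultimately have rel': "ev r0' m + ev r1' m * t + ev r2' m * t^2 = 0" by simp
  have le: "degree r \<le> degree (pCons c r)" for c and r :: "'k poly" by (cases "r = 0") auto
  have lt: "degree r < degree (pCons c r)" if "r \<noteq> 0" for c and r :: "'k poly" using that by simp
  have "r0' = 0 \<and> r1' = 0 \<and> r2' = 0"
  proof (rule ccontr)
    assume nz: "\<not> (r0' = 0 \<and> r1' = 0 \<and> r2' = 0)"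
    then consider "r0' \<noteq> 0" | "r1' \<noteq> 0" | "r2' \<noteq> 0" by blast
    hence "degree r0' + degree r1' + degree r2' < degree r0 + degree r1 + degree r2"
      unfolding r0 r1 r2
      by cases (use le[of r0' c0] le[of r1' c1] le[of r2' c2] lt[of r0' c0] lt[of r1' c1] lt[of r2' c2] in linarith)+
    from less.hyps[OF this rel'] nz show False by blast
  qed
  thus ?case by (simp add: r0 r1 r2 c)
qed

lemma rat_relation_degree_num:
  assumes t: "trans_elt t" and m: "m = ev p t / ev q t" "q \<noteq> 0"
    and cop: "\<And>z. poly p z \<noteq> 0 \<or> poly q z \<noteq> 0"
    and a: "a0 \<in> rat m" "a1 \<in> rat m" "a2 \<in> rat m" "a0 + a1 * t + a2 * t^2 = 0"
      "a0 \<noteq> 0 \<or> a1 \<noteq> 0 \<or> a2 \<noteq> 0"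
  shows "degree p \<le> 2"
proof (rule ccontr)
  assume deg: "\<not> degree p \<le> 2"
  obtain r0 s0 where a0: "ev s0 m \<noteq> 0" "a0 = ev r0 m / ev s0 m" using a(1) by (elim ratE)
  obtain r1 s1 where a1: "ev s1 m \<noteq> 0" "a1 = ev r1 m / ev s1 m" using a(2) by (elim ratE)
  obtain r2 s2 where a2: "ev s2 m \<noteq> 0" "a2 = ev r2 m / ev s2 m" using a(3) by (elim ratE)
  have "ev (r0 * s1 * s2) m + ev (r1 * s0 * s2) m * t + ev (r2 * s0 * s1) m * t^2
      = (a0 + a1 * t + a2 * t^2) * (ev s0 m * ev s1 m * ev s2 m)"
  proof -
    have "ev r0 m = a0 * ev s0 m" "ev r1 m = a1 * ev s1 m" "ev r2 m = a2 * ev s2 m"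
      using a0 a1 a2 by simp_all
    thus ?thesis by (simp add: ev_mult algebra_simps)
  qed
  hence rel: "ev (r0 * s1 * s2) m + ev (r1 * s0 * s2) m * t + ev (r2 * s0 * s1) m * t^2 = 0"
    using a(4) by simp
  have "p \<noteq> 0" "2 < degree p" using deg by auto
  hence "r0 * s1 * s2 = 0 \<and> r1 * s0 * s2 = 0 \<and> r2 * s0 * s1 = 0"
    by (rule quadratic_relation_degree[OF t m _ cop _ rel])
  moreover have "s0 \<noteq> 0" "s1 \<noteq> 0" "s2 \<noteq> 0" using a0 a1 a2 by (auto simp: ev_0)
  ultimately show False using a(5) a0 a1 a2 by (auto simp: ev_0)
qed

text \<open>The bound on \<open>degree q\<close> is the numerator bound for
  \<open>inverse m\<close>, which generates the same field and exchanges \<open>p\<close> and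
  \<open>q\<close>.\<close>

lemma rat_relation_degree:
  assumes t: "trans_elt t" and m: "m = ev p t / ev q t" "q \<noteq> 0"
    and cop: "\<And>z. poly p z \<noteq> 0 \<or> poly q z \<noteq> 0"
    and a: "a0 \<in> rat m" "a1 \<in> rat m" "a2 \<in> rat m" "a0 + a1 * t + a2 * t^2 = 0"
      "a0 \<noteq> 0 \<or> a1 \<noteq> 0 \<or> a2 \<noteq> 0"
  shows "max (degree p) (degree q) \<le> 2"
proof -
  have "degree p \<le> 2" by (rule rat_relation_degree_num[OF t m cop a])
  moreover have "degree q \<le> 2"
  proof (cases "p = 0")
    case True
    have "degree q = 0"
    proof (rule ccontr)
      assume "degree q \<noteq> 0"
      then obtain z where "poly q z = 0" using alg_closed_imp_poly_has_root[of q] by auto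
      thus False using cop[of z] True by simp
    qed
    thus ?thesis by simp
  next
    case False
    have "poly q z \<noteq> 0 \<or> poly p z \<noteq> 0" for z using cop[of z] by auto
    moreover have "inverse m = ev q t / ev p t" using m by simp
    ultimately show ?thesis
      using rat_relation_degree_num[OF t _ False, of "inverse m" q a0 a1 a2] a rat_inverse_subset[of m] by blast
  qed
  ultimately show ?thesis by simp
qed

text \<open>Replaces the generators of \<open>k(al, be)\<close> by a pair \<open>m\<close>,
  \<open>de\<close> that behaves well under conjugation \<open>w \<mapsto> -w\<close>:
  \<open>m\<close> is fixed and \<open>de\<close> changes sign. The clauses on
  \<open>quad m de\<close> and on \<open>S\<close> together say
  \<open>k(al, be) = k(m, de)\<close>.\<close>

lemma symmetric_point_quartic:
  assumes t: "trans_elt t" and w: "w^2 \<in> rat t" "w \<notin> rat t"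
    and al: "al \<in> quad t w" "al \<notin> range emb" and be: "be \<in> quad t w"
    and eq: "be^2 = al^3 + emb A2 * al^2 + emb A4 * al + emb A6"
    and disc: "qdisc 0 1 A2 A4 A6 \<noteq> 0"
  obtains a b c d e m de r where "m \<in> rat t" "r \<in> rat t" "de = r * w"
    "de^2 = qform (emb a) (emb b) (emb c) (emb d) (emb e) m 1"
    "al \<in> quad m de" "be \<in> quad m de"
    "\<And>S. kfield S \<Longrightarrow> al \<in> S \<Longrightarrow> be \<in> S \<Longrightarrow> m \<in> S \<and> de \<in> S"
    "qdisc a b c d e \<noteq> 0" "qj a b c d e = qj 0 1 A2 A4 A6"
proof -
  note D = kfieldD[OF kfield_rat[of t]]
  obtain a0 a1 where a: "a0 \<in> rat t" "a1 \<in> rat t" "al = a0 + a1 * w" using al(1) by (elim quadE)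
  obtain b0 b1 where b: "b0 \<in> rat t" "b1 \<in> rat t" "be = b0 + b1 * w" using be by (elim quadE)
  have indep: "x = 0 \<and> y = 0" if "x \<in> rat t" "y \<in> rat t" "x + y * w = 0" for x y
  proof -
    have "y = 0"
    proof (rule ccontr)
      assume "y \<noteq> 0"
      hence "w = - x / y" using that(3) by (simp add: field_simps eq_neg_iff_add_eq_0)
      thus False using w(2) that D(8,9) by metis
    qed
    thus ?thesis using that(3) by simp
  qed
  have xi: "x \<in> range emb" if "x \<in> rat t" "y \<in> rat t" "y^2 = x^3 + emb A2 * x^2 + emb A4 * x + emb A6" for x y
    using rat_point_const[OF t disc that(1,2)] that(3) by (simp add: qform_def emb_simps)
  define h where "h = w^2"
  have hr: "h \<in> rat t" using w by (simp add: h_def)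
  show ?thesis
  proof (cases "a1 = 0")
    \<comment> \<open>Here \<open>al\<close> is fixed by conjugation and \<open>be\<close> changes
      sign, so the line is vertical and its third point lies at infinity; the abscissa itself serves
      as \<open>m\<close>.\<close>
    case True
    hence al0: "al = a0" using a by simp
    have "(b0^2 + b1^2 * h - (al^3 + emb A2 * al^2 + emb A4 * al + emb A6)) + (2 * b0 * b1) * w = be^2 - (al^3 + emb A2 * al^2 + emb A4 * al + emb A6)"
      unfolding b(3) h_def by (simp add: algebra_simps power2_eq_square)
    moreover have alr: "al \<in> rat t" using a(1) al0 by simp
    have "b0^2 + b1^2 * h - (al^3 + emb A2 * al^2 + emb A4 * al + emb A6) \<in> rat t" "2 * b0 * b1 \<in> rat t"
      by (intro D alr b hr)+
    ultimately have "2 * b0 * b1 = 0" using indep eq by (metis diff_self)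
    hence "b0 = 0 \<or> b1 = 0" using numeral_neq_0[of "num.Bit0 num.One"] by auto
    moreover have "b1 \<noteq> 0" using xi[of al be] eq b a al0 al(2) by auto
    ultimately have "b0 = 0" by blast
    hence "be = b1 * w" using b by simp
    moreover have "be^2 = qform (emb 0) (emb 1) (emb A2) (emb A4) (emb A6) al 1"
      using eq by (simp add: qform_def emb_simps)
    ultimately show ?thesis
      using that[of al b1 be 0 1 A2 A4 A6] al0 a b in_quad[where t=al and w=be] disc by auto
  next
    case False
    \<comment> \<open>\<open>l\<close> is the slope of the line through \<open>(al, be)\<close> and its conjugate, \<open>(x3, y3)\<close> the third
       intersection point, and \<open>de\<^sup>2\<close> the discriminant of the quadratic for the other two abscissas.\<close>
    define l where "l = b1 / a1"
    have b1: "b1 = l * a1" using False by (simp add: l_def)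
    have lr: "l \<in> rat t" unfolding l_def using a b by (intro D)
    define x3 where "x3 = l^2 - emb A2 - 2 * a0"
    define y3 where "y3 = b0 + l * (x3 - a0)"
    have x3r: "x3 \<in> rat t" unfolding x3_def using lr a by (intro D)
    have y3r: "y3 \<in> rat t" unfolding y3_def using lr a b x3r by (intro D)
    have id: "(b0^2 + b1^2 * h - (a0^3 + 3 * a0 * a1^2 * h + emb A2 * (a0^2 + a1^2 * h) + emb A4 * a0 + emb A6))
      + (2 * b0 * b1 - a1 * (3 * a0^2 + a1^2 * h + 2 * emb A2 * a0 + emb A4)) * w =
      be^2 - (al^3 + emb A2 * al^2 + emb A4 * al + emb A6)"
      unfolding b(3) a(3) h_def by Groebner_Basis.algebra
    have "b0^2 + b1^2 * h - (a0^3 + 3 * a0 * a1^2 * h + emb A2 * (a0^2 + a1^2 * h) + emb A4 * a0 + emb A6) = 0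
      \<and> 2 * b0 * b1 - a1 * (3 * a0^2 + a1^2 * h + 2 * emb A2 * a0 + emb A4) = 0"
      by (rule indep, (intro D a b hr)+) (simp only: id, simp add: eq)
    hence re: "b0^2 + b1^2 * h = a0^3 + 3 * a0 * a1^2 * h + emb A2 * (a0^2 + a1^2 * h) + emb A4 * a0 + emb A6"
      and "a1 * (2 * b0 * l) = a1 * (3 * a0^2 + a1^2 * h + 2 * emb A2 * a0 + emb A4)"
      by (simp_all add: b1 algebra_simps)
    hence im: "2 * b0 * l = 3 * a0^2 + a1^2 * h + 2 * emb A2 * a0 + emb A4"
      using False mult_left_cancel by blast
    have p3: "y3^2 = x3^3 + emb A2 * x3^2 + emb A4 * x3 + emb A6"
      using re im unfolding y3_def x3_def b1 by Groebner_Basis.algebra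
    obtain x3' where x3': "x3 = emb x3'" using xi[OF x3r y3r p3] by blast
    have "y3^2 = emb (x3'^3 + A2 * x3'^2 + A4 * x3' + A6)" using p3 by (simp add: x3' emb_simps)
    then obtain y3' where y3': "y3 = emb y3'" using sqrt_in_range_emb by blast
    have p3': "y3'^2 = x3'^3 + A2 * x3'^2 + A4 * x3' + A6"
      using p3 emb_eq_iff by (simp add: x3' y3' flip: emb_simps)
    define de where "de = 2 * a1 * w"
    \<comment> \<open>Vieta's formulas for the line of slope \<open>l\<close> through
      \<open>(x3', y3')\<close> give \<open>de^2\<close> as a monic quartic in \<open>l\<close>
      without cubic term.\<close>
    define cc dd ee where "cc = - (6 * x3' + 2 * A2)" "dd = 8 * y3'"
      "ee = A2^2 - 2 * A2 * x3' - 3 * x3'^2 - 4 * A4"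
    have de2: "de^2 = qform (emb 1) (emb 0) (emb cc) (emb dd) (emb ee) l 1"
    proof -
      have "de^2 = l^4 - (6 * x3 + 2 * emb A2) * l^2 + 8 * y3 * l + ((emb A2)^2 - 2 * emb A2 * x3 - 3 * x3^2 - 4 * emb A4)"
        using im unfolding de_def h_def y3_def x3_def by Groebner_Basis.algebra
      thus ?thesis by (simp add: qform_def cc_dd_ee_def emb_simps x3' y3' algebra_simps)
    qed
    note Q = kfieldD[OF kfield_quad[of de l]]
    have dr: "de^2 \<in> rat l"
      unfolding de2 qform_def by (intro kfieldD[OF kfield_rat[of l]] in_rat)
    have two: "(2::'a) \<noteq> 0" by (rule numeral_neq_0)
    have al': "al = (de + l^2 - emb A2 - x3) / 2"
      using two unfolding de_def a(3) x3_def by (simp add: field_simps)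
    have alq: "al \<in> quad l de"
      unfolding al' x3' by (intro Q dr in_quad)
    have be': "be = y3 + l * (al - x3)" unfolding b(3) a(3) y3_def b1 by (simp add: algebra_simps)
    have beq: "be \<in> quad l de" unfolding be' y3' x3' by (intro Q dr in_quad alq)
    have gen: "l \<in> S \<and> de \<in> S" if S: "kfield S" "al \<in> S" "be \<in> S" for S
    proof -
      have "al \<noteq> x3" using al(2) x3' by auto
      hence l: "l = (be - emb y3') / (al - emb x3')" unfolding be' y3' x3' by simp
      have lS: "l \<in> S" unfolding l by (intro kfieldD[OF S(1)] S)
      have "de = 2 * al + emb x3' + emb A2 - l^2" using two unfolding al' x3' by (simp add: field_simps)
      thus ?thesis using lS S by (auto intro!: kfieldD[OF S(1)])
    qed
    have I: "invI 1 0 cc dd ee = 4^2 * invI 0 1 A2 A4 A6"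
      unfolding invI_def cc_dd_ee_def by Groebner_Basis.algebra
    have A6: "A6 = y3'^2 - x3'^3 - A2 * x3'^2 - A4 * x3'" using p3' by simp
    have J: "invJ 1 0 cc dd ee = 4^3 * invJ 0 1 A2 A4 A6"
      unfolding invJ_def cc_dd_ee_def A6 power_one mult_1_right power_zero_numeral mult_zero_left mult_zero_right
    by Groebner_Basis.algebra
    have "qdisc 1 0 cc dd ee = 4^6 * qdisc 0 1 A2 A4 A6" unfolding qdisc_def I J by Groebner_Basis.algebra
    hence disc': "qdisc 1 0 cc dd ee \<noteq> 0" using disc by simp
    have j: "qj 1 0 cc dd ee = qj 0 1 A2 A4 A6"
      using qj_eqI[OF I J] qj_eqI[of 0 1 A2 A4 A6 1] by simp
    have "2 * a1 \<in> rat t" using a by (intro D)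
    thus ?thesis using that[OF lr _ de_def de2 alq beq gen disc' j] by blast
  qed
qed

text \<open>\<open>Mmin\<close> identifies \<open>M\<close> with \<open>k(al, be)\<close>;
  \<open>span\<close> bounds its index by 2 and \<open>neq\<close> excludes index 1.\<close>

lemma Phi2_of_index_2_subfield:
  assumes t: "trans_elt t" and w: "w^2 = ev g t" and g: "degree g = 3"
    and gdisc: "qdisc 0 (coeff g 3) (coeff g 2) (coeff g 1) (coeff g 0) \<noteq> 0"
    and al: "al \<in> quad t w" "al \<notin> range emb" and be: "be \<in> quad t w"
    and eq: "be^2 = al^3 + emb A2 * al^2 + emb A4 * al + emb A6"
    and disc: "qdisc 0 1 A2 A4 A6 \<noteq> 0"
    and M: "kfield M" "M \<subseteq> quad t w" "al \<in> M" "be \<in> M"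
    and Mmin: "\<And>S. kfield S \<Longrightarrow> al \<in> S \<Longrightarrow> be \<in> S \<Longrightarrow> M \<subseteq> S"
    and span: "quad t w = {x * v1 + y * v2 | x y. x \<in> M \<and> y \<in> M}" and neq: "quad t w \<noteq> M"
  shows "Phi2 (qj 0 1 A2 A4 A6) (qj 0 (coeff g 3) (coeff g 2) (coeff g 1) (coeff g 0)) = 0"
proof -
  note D = kfieldD[OF kfield_rat[of t]]
  have wr: "w^2 \<in> rat t" unfolding w by (rule ev_in_rat)
  have wn: "w \<notin> rat t" by (rule not_rat_of_odd_degree[OF t w]) (simp add: g)
  have gs: "\<not> [:-z, 1:]^2 dvd g" for z by (rule cubic_squarefree) (use g gdisc in auto)
  obtain a b c d e m de r where m: "m \<in> rat t" "r \<in> rat t" "de = r * w"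
    "de^2 = qform (emb a) (emb b) (emb c) (emb d) (emb e) m 1"
    "al \<in> quad m de" "be \<in> quad m de"
    "\<And>S. kfield S \<Longrightarrow> al \<in> S \<Longrightarrow> be \<in> S \<Longrightarrow> m \<in> S \<and> de \<in> S"
    "qdisc a b c d e \<noteq> 0" "qj a b c d e = qj 0 1 A2 A4 A6"
    by (rule symmetric_point_quartic[OF t wr wn al be eq disc]) (rule that)
  have dr: "de^2 \<in> rat m" unfolding m(4) qform_def by (intro kfieldD[OF kfield_rat[of m]] in_rat)
  have Mq: "M \<subseteq> quad m de" by (rule Mmin[OF kfield_quad[OF dr] m(5,6)])
  have mM: "m \<in> M" "de \<in> M" using m(7)[OF M(1,3,4)] by auto
  have mc: "m \<notin> range emb"
  proof
    assume "m \<in> range emb"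
    moreover from this obtain m' where "m = emb m'" by blast
    hence "de^2 = emb (qform a b c d e m' 1)" using m(4) by (simp add: emb_qform emb_1)
    hence "de \<in> range emb" by (rule sqrt_in_range_emb)
    ultimately have "quad m de \<subseteq> range emb" by (intro quad_subset kfield_range_emb)
    thus False using m(5) al(2) by blast
  qed
  have r0: "r \<noteq> 0"
  proof
    assume "r = 0"
    hence "de = 0" using m(3) by simp
    hence "quad m de \<subseteq> rat t" using m(1) by (intro quad_subset kfield_rat) (auto intro: D)
    hence "al \<in> rat t" "be \<in> rat t" using m(5,6) by auto
    thus False using rat_point_const[OF t disc, of al be] eq al(2) by (simp add: qform_def emb_simps)
  qed
  have rm: "rat m \<subseteq> rat t" by (rule rat_subset[OF kfield_rat m(1)])

  \<comment> \<open>\<open>1\<close>, \<open>t\<close> and \<open>t^2\<close> lie in the span of two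
    elements over \<open>M\<close>, hence are dependent. The coefficients are the 2 by 2 minors of
    the coordinate matrix; if the minor of \<open>1\<close> and \<open>t\<close> vanishes, these two
    are already dependent.\<close>
  obtain m0 m1 m2 where mi: "m0 \<in> M" "m1 \<in> M" "m2 \<in> M" "m0 + m1 * t + m2 * t^2 = 0"
    "m0 \<noteq> 0 \<or> m1 \<noteq> 0 \<or> m2 \<noteq> 0"
  proof -
    have "1 \<in> quad t w" "t \<in> quad t w" "t^2 \<in> quad t w"
      by (intro kfieldD[OF kfield_quad[OF wr]] in_quad)+
    then obtain x0 y0 x1 y1 x2 y2 where x: "1 = x0 * v1 + y0 * v2" "t = x1 * v1 + y1 * v2" "t^2 = x2 * v1 + y2 * v2"
      and xM: "x0 \<in> M" "y0 \<in> M" "x1 \<in> M" "y1 \<in> M" "x2 \<in> M" "y2 \<in> M"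
      unfolding span by blast
    have MM: "x * y - z * u \<in> M" if "x \<in> M" "y \<in> M" "z \<in> M" "u \<in> M" for x y z u
      using that by (intro kfieldD[OF M(1)])
    show ?thesis
    proof (cases "x0 * y1 - x1 * y0 = 0")
      case True
      show ?thesis
      proof (cases "x0 = 0")
        case False
        have "x1 * 1 - x0 * t = - (x0 * y1 - x1 * y0) * v2"
          by (subst x(1), subst x(2)) (simp add: algebra_simps)
        hence "x1 * 1 - x0 * t = 0" unfolding True by simp
        thus ?thesis using that[of x1 "- x0" 0] False xM kfieldD[OF M(1)] by auto
      next
        case True': True
        hence y0: "y0 \<noteq> 0" using x(1) by auto
        have "y1 * 1 - y0 * t = (x0 * y1 - x1 * y0) * v1"
          by (subst x(1), subst x(2)) (simp add: algebra_simps)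
        hence "y1 * 1 - y0 * t = 0" unfolding True by simp
        thus ?thesis using that[of y1 "- y0" 0] y0 xM kfieldD[OF M(1)] by auto
      qed
    next
      case False
      have "(x1 * y2 - x2 * y1) + (x2 * y0 - x0 * y2) * t + (x0 * y1 - x1 * y0) * t^2 = 0"
      proof -
        have "(x1 * y2 - x2 * y1) * 1 + (x2 * y0 - x0 * y2) * t + (x0 * y1 - x1 * y0) * t^2 = 0"
          unfolding x(3) by (subst x(1), subst (1) x(2)) (simp add: algebra_simps)
        thus ?thesis by simp
      qed
      moreover have "x1 * y2 - x2 * y1 \<in> M" "x2 * y0 - x0 * y2 \<in> M" "x0 * y1 - x1 * y0 \<in> M"
        by (intro MM xM)+
      ultimately show ?thesis using that False by simp
    qed
  qed
  \<comment> \<open>Since \<open>de = r * w\<close>, comparing components along \<open>1\<close> and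
    \<open>w\<close> turns the relation over \<open>M\<close> into two relations over
    \<open>k(m)\<close>, at least one of them nontrivial.\<close>
  obtain p0 q0 where 0: "p0 \<in> rat m" "q0 \<in> rat m" "m0 = p0 + q0 * de" using mi(1) Mq quadE by blast
  obtain p1 q1 where 1: "p1 \<in> rat m" "q1 \<in> rat m" "m1 = p1 + q1 * de" using mi(2) Mq quadE by blast
  obtain p2 q2 where 2: "p2 \<in> rat m" "q2 \<in> rat m" "m2 = p2 + q2 * de" using mi(3) Mq quadE by blast
  have sum: "(p0 + p1 * t + p2 * t^2) + ((q0 + q1 * t + q2 * t^2) * r) * w = 0"
    using mi(4) unfolding 0 1 2 m(3) by (simp add: algebra_simps)
  have P: "p0 + p1 * t + p2 * t^2 \<in> rat t" "q0 + q1 * t + q2 * t^2 \<in> rat t"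
    using 0 1 2 rm in_rat[of t] by (auto intro!: D)
  have Q: "q0 + q1 * t + q2 * t^2 = 0"
  proof (rule ccontr)
    assume n: "q0 + q1 * t + q2 * t^2 \<noteq> 0"
    have quot: "w = - A / B" if "A + B * w = 0" "B \<noteq> 0" for A B
      using that by (simp add: field_simps eq_neg_iff_add_eq_0)
    have "w = - (p0 + p1 * t + p2 * t^2) / ((q0 + q1 * t + q2 * t^2) * r)"
      by (rule quot[OF sum]) (use r0 n in simp)
    moreover have "\<dots> \<in> rat t" by (intro D P m(2))
    ultimately show False using wn by simp
  qed
  hence P0: "p0 + p1 * t + p2 * t^2 = 0" using sum by simp
  obtain p q where pq: "q \<noteq> 0" "m = ev p t / ev q t" "\<And>z. poly p z \<noteq> 0 \<or> poly q z \<noteq> 0"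
    using rat_coprimeE[OF t m(1)] by blast
  have qt: "ev q t \<noteq> 0" using t pq(1) by (auto simp: trans_elt_def)
  have "(p0 \<noteq> 0 \<or> p1 \<noteq> 0 \<or> p2 \<noteq> 0) \<or> (q0 \<noteq> 0 \<or> q1 \<noteq> 0 \<or> q2 \<noteq> 0)"
    using mi(5) unfolding 0 1 2 by auto
  hence le2: "max (degree p) (degree q) \<le> 2"
    using rat_relation_degree[OF t pq(2,1,3) 0(1) 1(1) 2(1) P0]
      rat_relation_degree[OF t pq(2,1,3) 0(2) 1(2) 2(2) Q] by blast
  have wpq: "wronskian p q \<noteq> 0"
  proof
    assume "wronskian p q = 0"
    hence "degree p = 0" "degree q = 0" using wronskian_eq_0_imp_degree_0 pq(3) by blast+
    then obtain c d where "p = [:c:]" "q = [:d:]" by (metis degree_eq_zeroE)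
    hence "m = emb (c * inverse d)" using pq(2) by (simp add: ev_simps emb_mult emb_inverse divide_inverse)
    thus False using mc by blast
  qed
  \<comment> \<open>In degree 1, \<open>m\<close> would be a Moebius transform of \<open>t\<close>,
    so \<open>t\<close> and then \<open>w = de / r\<close> would lie in \<open>M\<close>, making
    \<open>M\<close> the whole field.\<close>
  have deg: "max (degree p) (degree q) = 2"
  proof (rule ccontr)
    assume "max (degree p) (degree q) \<noteq> 2"
    hence "degree p \<le> 1" "degree q \<le> 1" using le2 by auto
    hence "p = [:coeff p 0, coeff p 1:]" "q = [:coeff q 0, coeff q 1:]"
      by (intro poly_eqI; auto simp: coeff_pCons coeff_eq_0 split: nat.splits)+
    then obtain p0 p1 q0 q1 where p: "p = [:p0, p1:]" and q: "q = [:q0, q1:]" by blast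
    have rel: "t * (m * emb q1 - emb p1) = emb p0 - m * emb q0"
      using pq(2) qt unfolding p q by (simp add: ev_simps field_simps)
    have nz: "m * emb q1 - emb p1 \<noteq> 0"
    proof
      assume z: "m * emb q1 - emb p1 = 0"
      show False
      proof (cases "q1 = 0")
        case True
        hence "p1 = 0" using z by (simp add: emb_simps emb_eq_0_iff)
        thus False using wpq True unfolding p q by (simp add: wronskian_def pderiv_pCons)
      next
        case False
        hence "m = emb (p1 * inverse q1)"
          using z unfolding emb_mult emb_inverse by (simp add: emb_eq_0_iff field_simps)
        thus False using mc by blast
      qed
    qed
    have "t = (emb p0 - m * emb q0) / (m * emb q1 - emb p1)" using rel nz by (simp add: field_simps)
    hence tM: "t \<in> M" using mM(1) by (auto intro!: kfieldD[OF M(1)])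
    have "rat t \<subseteq> M" by (rule rat_subset[OF M(1) tM])
    moreover have "w = de / r" using m(3) r0 by simp
    ultimately have "w \<in> M" using m(2) mM(2) by (auto intro!: kfieldD[OF M(1)])
    thus False using quad_subset[OF M(1) tM] M(2) neq by blast
  qed
  have "qform (emb a) (emb b) (emb c) (emb d) (emb e) m 1 = ev g t * r^2"
    using m(4) unfolding m(3) w[symmetric] by (simp add: power_mult_distrib mult.commute)
  then obtain s where "pform a b c d e p q = g * s^2"
    using pform_eq_of_rat_point[OF t gs pq(1,2) m(2)] by blast
  from Phi2_qj_of_degree_2[OF this m(8) pq(3) deg wpq g] show ?thesis unfolding m(9) .
qed

end

section \<open>Subfields of the type-class field as structures\<close>

lemma type_ring_simps:
  "carrier (ring_of_type_algebra :: 'a::field ring) = UNIV"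
  "x \<otimes>\<^bsub>ring_of_type_algebra\<^esub> y = x * (y :: 'a::field)"
  "x \<oplus>\<^bsub>ring_of_type_algebra\<^esub> y = x + (y :: 'a::field)"
  "\<one>\<^bsub>ring_of_type_algebra\<^esub> = (1 :: 'a::field)"
  "\<zero>\<^bsub>ring_of_type_algebra\<^esub> = (0 :: 'a::field)"
  by (simp_all add: ring_of_type_algebra_def)

lemma type_ring_a_inv: "\<ominus>\<^bsub>ring_of_type_algebra\<^esub> x = - (x :: 'a::field)"
proof -
  interpret field "ring_of_type_algebra :: 'a ring" by (rule field_from_type_algebra)
  show ?thesis by (rule minus_equality) (simp_all add: type_ring_simps)
qed

lemma type_ring_m_inv: "x \<noteq> 0 \<Longrightarrow> inv\<^bsub>ring_of_type_algebra\<^esub> x = inverse (x :: 'a::field)"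
proof -
  interpret field "ring_of_type_algebra :: 'a ring" by (rule field_from_type_algebra)
  show "x \<noteq> 0 \<Longrightarrow> inv\<^bsub>ring_of_type_algebra\<^esub> x = inverse x"
    by (rule comm_inv_char) (simp_all add: type_ring_simps)
qed

lemma type_ring_nat_pow: "x [^]\<^bsub>ring_of_type_algebra\<^esub> (n::nat) = (x :: 'a::field) ^ n"
proof -
  interpret field "ring_of_type_algebra :: 'a ring" by (rule field_from_type_algebra)
  show ?thesis by (induction n) (simp_all add: type_ring_simps)
qed

lemma type_ring_eval_snoc:
  "ring.eval ring_of_type_algebra (l @ [a]) x = ring.eval ring_of_type_algebra l x * x + (a :: 'a::field)"
proof -
  interpret field "ring_of_type_algebra :: 'a ring" by (rule field_from_type_algebra)
  show ?thesis by (induction l) (simp_all add: type_ring_simps type_ring_nat_pow algebra_simps)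
qed

text \<open>Unfolds the inductive definition of dimension twice, down to the zero space. The last
  two facts record independence and later exclude index 1.\<close>

lemma type_ring_dimension_2D:
  fixes K E :: "'a::field set"
  assumes "ring.dimension ring_of_type_algebra 2 K E" "0 \<in> K"
  obtains v1 v2 where "E = {x * v1 + y * v2 | x y. x \<in> K \<and> y \<in> K}" "v2 \<noteq> 0" "\<And>x. x \<in> K \<Longrightarrow> v1 \<noteq> x * v2"
proof -
  interpret field "ring_of_type_algebra :: 'a ring" by (rule field_from_type_algebra)
  have ext: "line_extension K v S = {x * v + s | x s. x \<in> K \<and> s \<in> S}" for v S
    by (auto simp: line_extension_def set_add_def set_mult_def r_coset_def type_ring_simps)
  have step: "\<exists>v S'. dimension n K S' \<and> v \<notin> S' \<and> S = line_extension K v S'"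
    if "dimension (Suc n) K S" for n S
    using that by (cases rule: dimension.cases) blast
  have "dimension (Suc (Suc 0)) K E" using assms(1) by (simp add: numeral_2_eq_2)
  then obtain v1 E1 where 1: "dimension (Suc 0) K E1" "v1 \<notin> E1" "E = line_extension K v1 E1"
    using step by blast
  then obtain v2 E0 where 2: "dimension 0 K E0" "v2 \<notin> E0" "E1 = line_extension K v2 E0"
    using step by blast
  have E0: "E0 = {0}" using 2(1) by (cases rule: dimension.cases) (simp add: type_ring_simps)
  have E1: "E1 = {y * v2 | y. y \<in> K}" unfolding 2(3) ext E0 by auto
  show ?thesis
  proof
    show "E = {x * v1 + y * v2 | x y. x \<in> K \<and> y \<in> K}" unfolding 1(3) ext E1 by auto
  qed (use 1(2) 2(2) E0 E1 in auto)
qed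

context field_embedding
begin

abbreviation gen :: "'a set \<Rightarrow> 'a set" where
  "gen A \<equiv> generate_field ring_of_type_algebra (range emb \<union> A)"

lemma kfield_gen: "kfield (gen A)"
  unfolding kfield_def
proof (intro conjI ballI subsetI)
  show "x \<in> range emb \<Longrightarrow> x \<in> gen A" for x by (rule generate_field.incl) simp
  show "x + y \<in> gen A" "x * y \<in> gen A" if "x \<in> gen A" "y \<in> gen A" for x y
    using generate_field.eng_add[OF that] generate_field.eng_mult[OF that] by (simp_all add: type_ring_simps)
  show "- x \<in> gen A" if "x \<in> gen A" for x
    using generate_field.a_inv[OF that] by (simp add: type_ring_a_inv)
  show "inverse x \<in> gen A" if "x \<in> gen A" for x
    using generate_field.m_inv[OF that] that by (cases "x = 0") (simp_all add: type_ring_simps type_ring_m_inv)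
qed

lemma gen_subset:
  assumes S: "kfield S" "A \<subseteq> S"
  shows "gen A \<subseteq> S"
proof
  fix x assume "x \<in> gen A"
  thus "x \<in> S"
  proof (induction rule: generate_field.induct)
    case (incl h) thus ?case using S by (auto simp: kfield_def)
  qed (use kfieldD[OF S(1)] in \<open>simp_all add: type_ring_simps type_ring_a_inv type_ring_m_inv\<close>)
qed

lemma gen_eq_quad:
  assumes w: "w^2 \<in> rat t" and A: "A \<subseteq> quad t w" and t: "t \<in> gen A" and wg: "w \<in> gen A"
  shows "gen A = quad t w"
  using gen_subset[OF kfield_quad[OF w] A] quad_subset[OF kfield_gen t wg] by blast

text \<open>\<open>ring.eval\<close> reads coefficients from the leading one down,
  \<open>coeffs\<close> from the constant term up; hence the reversal.\<close>

lemma type_ring_eval_coeffs: "ring.eval ring_of_type_algebra (rev (map emb (coeffs p))) x = ev p x"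
proof -
  interpret field "ring_of_type_algebra :: 'a ring" by (rule field_from_type_algebra)
  show ?thesis
  proof (induction p)
    case 0 show ?case by (simp add: ev_0 type_ring_simps)
  next
    case (pCons c p)
    hence "coeffs (pCons c p) = c # coeffs p" by (auto simp: cCons_def)
    thus ?case using pCons.IH by (simp add: type_ring_eval_snoc ev_pCons algebra_simps)
  qed
qed

text \<open>\<open>transcendental\<close> is injectivity of evaluation on coefficient lists; a
  nonzero \<open>p\<close> vanishing at \<open>x\<close> would have the same value as the empty
  list, which is the zero polynomial.\<close>

lemma trans_elt_of_transcendental:
  assumes "ring.transcendental ring_of_type_algebra (range emb) x"
  shows "trans_elt x"
  unfolding trans_elt_def
proof (intro allI impI)
  interpret field "ring_of_type_algebra :: 'a ring" by (rule field_from_type_algebra)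
  fix p assume p: "ev p x = 0"
  show "p = 0"
  proof (rule ccontr)
    assume "p \<noteq> 0"
    hence "polynomial\<^bsub>ring_of_type_algebra\<^esub> (range emb) (rev (map emb (coeffs p)))"
      by (auto simp: polynomial_def hd_rev last_map last_coeffs_eq_coeff_degree emb_eq_0_iff type_ring_simps)
    moreover have "polynomial\<^bsub>ring_of_type_algebra\<^esub> (range emb) []" by (simp add: polynomial_def)
    moreover have "eval (rev (map emb (coeffs p))) x = eval [] x"
      using p by (simp add: type_ring_eval_coeffs type_ring_simps)
    ultimately have "rev (map emb (coeffs p)) = []"
      by (intro inj_onD[OF assms[unfolded transcendental_def]]) (simp_all add: univ_poly_def)
    thus False using \<open>p \<noteq> 0\<close> by simp
  qed
qed

section \<open>Transcendence of squares and inverses, and cubic models\<close>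

lemma ev_pcompose: "ev (pcompose p r) t = ev p (ev r t)"
  by (induction p) (simp_all add: ev_simps pcompose_pCons)

lemma trans_elt_square:
  assumes "trans_elt t" shows "trans_elt (t^2)"
  unfolding trans_elt_def
proof (intro allI impI)
  fix p assume "ev p (t^2) = 0"
  moreover have "t^2 = ev [:0, 0, 1:] t" by (simp add: ev_simps emb_simps power2_eq_square)
  ultimately have "pcompose p [:0, 0, 1:] = 0" using assms unfolding trans_elt_def by (metis ev_pcompose)
  thus "p = 0" by (rule pcompose_eq_0) simp
qed

lemma trans_elt_inverse:
  assumes "trans_elt t" shows "trans_elt (inverse t)"
  unfolding trans_elt_def
proof (intro allI impI)
  fix p assume p: "ev p (inverse t) = 0"
  have "t \<noteq> 0"
  proof
    assume "t = 0"
    hence "ev [:0, 1:] t = 0" by (simp add: ev_simps emb_simps)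
    thus False using assms by (auto simp: trans_elt_def)
  qed
  hence "poly (reflect_poly (map_poly emb p)) t = 0"
    using p by (simp add: poly_reflect_poly_nz ev_def)
  moreover have "reflect_poly (map_poly emb p) = map_poly emb (reflect_poly p)"
    by (intro poly_eqI) (auto simp: coeff_map_poly emb_0 coeff_reflect_poly degree_map_poly emb_eq_0_iff)
  ultimately have "ev (reflect_poly p) t = 0" by (simp add: ev_def)
  hence "reflect_poly p = 0" using assms unfolding trans_elt_def by blast
  thus "p = 0" by simp
qed

definition cubic_model :: "'a \<Rightarrow> 'a \<Rightarrow> 'k \<Rightarrow> 'k \<Rightarrow> 'k \<Rightarrow> bool" where
  "cubic_model t w c2 c1 c0 \<longleftrightarrow> trans_elt t \<and> w^2 = t^3 + emb c2 * t^2 + emb c1 * t + emb c0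
     \<and> qdisc 0 1 c2 c1 c0 \<noteq> 0"

lemma cubic_model_square_in_rat: "cubic_model t w c2 c1 c0 \<Longrightarrow> w^2 \<in> rat t"
  by (auto simp: cubic_model_def intro!: kfieldD[OF kfield_rat] in_rat)

text \<open>The image \<open>M\<close> of \<open>\<phi>\<close> is the field generated over
  \<open>k\<close> by \<open>\<phi> t'\<close> and \<open>\<phi> w'\<close>, which satisfy the cubic
  equation of the source; it has index 2 in the target, so \<open>Phi2_of_index_2_subfield\<close>
  applies.\<close>

lemma Phi2_of_cubic_models:
  assumes E: "cubic_model t w c2 c1 c0" and F: "cubic_model t' w' d2 d1 d0"
    and hom: "\<phi> \<in> ring_hom (ring_of_type_algebra\<lparr>carrier := quad t' w'\<rparr>) (ring_of_type_algebra\<lparr>carrier := quad t w\<rparr>)"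
    and fix_k: "\<forall>c\<in>range emb. \<phi> c = c"
    and dim: "ring.dimension ring_of_type_algebra 2 (\<phi> ` quad t' w') (quad t w)"
  shows "Phi2 (qj 0 1 d2 d1 d0) (qj 0 1 c2 c1 c0) = 0"
proof -
  let ?F = "quad t' w'" and ?E = "quad t w"
  define M where "M = \<phi> ` ?F"
  have KF: "kfield ?F" by (rule kfield_quad[OF cubic_model_square_in_rat[OF F]])
  note DF = kfieldD[OF KF]
  have t': "t' \<in> ?F" "w' \<in> ?F" by (rule in_quad)+
  have add: "\<phi> (x + y) = \<phi> x + \<phi> y" and mult: "\<phi> (x * y) = \<phi> x * \<phi> y" if "x \<in> ?F" "y \<in> ?F" for x y
    using ring_hom_add[OF hom, of x y] ring_hom_mult[OF hom, of x y] that by (simp_all add: type_ring_simps)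
  have img: "\<phi> x \<in> ?E" if "x \<in> ?F" for x using ring_hom_closed[OF hom, of x] that by simp
  have emb: "\<phi> (emb c) = emb c" for c using fix_k by simp
  have z: "\<phi> 0 = 0" and o: "\<phi> 1 = 1" using emb[of 0] emb[of 1] by (simp_all add: emb_simps)
  have minus: "\<phi> (- x) = - \<phi> x" if "x \<in> ?F" for x
    using mult[of "emb (-1)" x] that emb[of "-1"] DF(1)[of "-1"] by (simp add: emb_simps)
  have inv: "\<phi> (inverse x) = inverse (\<phi> x)" if x: "x \<in> ?F" for x
  proof (cases "x = 0")
    case False
    have "\<phi> x * \<phi> (inverse x) = 1" using mult[of x "inverse x"] x DF(10)[OF x] False o by simp
    thus ?thesis by (metis inverse_unique)
  qed (simp add: z)
  have inj: "x = 0" if "x \<in> ?F" "\<phi> x = 0" for x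
  proof (rule ccontr)
    assume "x \<noteq> 0"
    hence "\<phi> x * \<phi> (inverse x) = 1" using mult[of x "inverse x"] that DF(10)[OF that(1)] o by simp
    thus False using that(2) by simp
  qed
  have KM: "kfield M"
    unfolding kfield_def
  proof (intro conjI ballI subsetI)
    show "x \<in> M" if "x \<in> range emb" for x
      using that emb DF(1) unfolding M_def by (metis imageE imageI)
    show "x + y \<in> M" "x * y \<in> M" if xy: "x \<in> M" "y \<in> M" for x y
    proof -
      obtain x' y' where "x = \<phi> x'" "y = \<phi> y'" "x' \<in> ?F" "y' \<in> ?F" using xy by (auto simp: M_def)
      thus "x + y \<in> M" "x * y \<in> M" unfolding M_def using add[of x' y'] mult[of x' y'] DF(5,6)[of x' y']
        by (metis imageI)+
    qed
    show "- x \<in> M" "inverse x \<in> M" if x: "x \<in> M" for x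
    proof -
      obtain x' where "x = \<phi> x'" "x' \<in> ?F" using x by (auto simp: M_def)
      thus "- x \<in> M" "inverse x \<in> M" unfolding M_def using minus[of x'] inv[of x'] DF(9,10)[of x']
        by (metis imageI)+
    qed
  qed
  have Mmin: "M \<subseteq> S" if S: "kfield S" "\<phi> t' \<in> S" "\<phi> w' \<in> S" for S
  proof -
    have "kfield {x \<in> ?F. \<phi> x \<in> S}"
      unfolding kfield_def using emb add mult minus inv
      by (auto intro!: DF(1,5,6,9,10) simp: kfieldD(1)[OF S(1)] kfieldD(5,6,9,10)[OF S(1)])
    hence "?F \<subseteq> {x \<in> ?F. \<phi> x \<in> S}" by (rule quad_subset) (use t' S in auto)
    thus ?thesis by (auto simp: M_def)
  qed
  have nc: "\<phi> t' \<notin> range emb"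
  proof
    assume "\<phi> t' \<in> range emb"
    then obtain c where c: "\<phi> t' = emb c" by blast
    have "\<phi> (t' + emb (-c)) = 0" unfolding add[OF t'(1) DF(1)] emb c by (simp add: emb_simps)
    hence "t' + emb (-c) = 0" by (rule inj[OF DF(5)[OF t'(1) DF(1)]])
    hence "ev [:-c, 1:] t' = 0" by (simp add: ev_simps emb_simps)
    thus False using F by (auto simp: cubic_model_def trans_elt_def)
  qed
  have eq: "(\<phi> w')^2 = (\<phi> t')^3 + emb d2 * (\<phi> t')^2 + emb d1 * \<phi> t' + emb d0"
  proof -
    have pw: "\<phi> (x ^ n) = \<phi> x ^ n" if "x \<in> ?F" for x n
      using that by (induction n) (simp_all add: o mult DF(11))
    have "\<phi> (w'^2) = \<phi> (t'^3 + emb d2 * t'^2 + emb d1 * t' + emb d0)"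
      using F by (simp add: cubic_model_def)
    thus ?thesis by (simp add: pw add mult emb t' DF)
  qed
  obtain v1 v2 where v: "?E = {x * v1 + y * v2 | x y. x \<in> M \<and> y \<in> M}" "v2 \<noteq> 0" "\<And>x. x \<in> M \<Longrightarrow> v1 \<noteq> x * v2"
    using type_ring_dimension_2D[OF dim] kfieldD(2)[OF KM] unfolding M_def by blast
  have neq: "?E \<noteq> M"
  proof
    assume eqM: "?E = M"
    have "v1 = 1 * v1 + 0 * v2" "v2 = 0 * v1 + 1 * v2" by simp_all
    hence "v1 \<in> ?E" "v2 \<in> ?E" unfolding v(1) using kfieldD(2,3)[OF KM] by blast+
    hence "v1 / v2 \<in> M" unfolding eqM by (rule kfieldD(8)[OF KM])
    thus False using v(2) v(3)[of "v1 / v2"] by simp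
  qed
  define g where "g = [:c0, c1, c2, 1:]"
  have cg: "coeff g 3 = 1" "coeff g 2 = c2" "coeff g 1 = c1" "coeff g 0 = c0"
    by (simp_all add: g_def eval_nat_numeral)
  have "w^2 = ev g t"
    using E by (simp add: cubic_model_def g_def ev_simps emb_simps algebra_simps power2_eq_square power3_eq_cube)
  moreover have "degree g = 3" by (simp add: g_def)
  moreover have "M \<subseteq> ?E" "\<phi> t' \<in> M" "\<phi> w' \<in> M" using img t' by (auto simp: M_def)
  ultimately show ?thesis
    using Phi2_of_index_2_subfield[of t w g "\<phi> t'" "\<phi> w'" d2 d1 d0 M v1 v2] E F img t' nc eq KM Mmin v(1) neq
    unfolding cg cubic_model_def by blast
qed

end

theorem mainTheorem5:
  fixes emb :: "'k::{alg_closed_field, field_char_0} \<Rightarrow> 'a::field"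
    and s1 s2 u v :: 'k
    and x y :: 'a
    and R :: "'a ring"
    and k K E1 E2 :: "'a set"
  assumes R: "R = ring_of_type_algebra"
    and emb: "emb \<in> ring_hom ring_of_type_algebra R"
    and k: "k = range emb"
    and disc: "27 - 18*s1*s2 - s1^2*s2^2 + 4*s1^3 + 4*s2^3 \<noteq> 0"
    and x: "ring.transcendental R k x"
    and y: "y^2 = x^6 - emb s1 * x^4 + emb s2 * x^2 - 1"
    and K: "K = generate_field R (k \<union> {x, y})"
    and E1: "E1 = generate_field R (k \<union> {x^2, y})"
    and E2: "E2 = generate_field R (k \<union> {x^2, x * y})"
    and u: "u = s1 * s2"
    and v: "v = s1^3 + s2^3"
    and isog: "isogenous_of_degree R k 2 E1 E2"
  shows "isog2_f1 u v * isog2_f2 u v = 0"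
proof -
  interpret field_embedding emb
    using ring_hom_add[OF emb] ring_hom_mult[OF emb] ring_hom_one[OF emb]
    by unfold_locales (simp_all add: R type_ring_simps)
  have tx: "trans_elt x" using x unfolding R k by (rule trans_elt_of_transcendental)
  have x0: "x \<noteq> 0"
  proof
    assume "x = 0"
    hence "ev [:0, 1:] x = 0" by (simp add: ev_simps emb_simps)
    thus False using tx by (auto simp: trans_elt_def)
  qed
  have qd: "qdisc 0 1 (-s1) s2 (-1) \<noteq> 0" "qdisc 0 1 (-s2) s1 (-1) \<noteq> 0"
    unfolding qdisc_cubic(1)[of s1 s2] qdisc_cubic(2)[of s2 s1] mult_eq_0_iff using disc by simp_all
  have M1: "cubic_model (x^2) y (-s1) s2 (-1)"
    using trans_elt_square[OF tx] qd(1) y by (simp add: cubic_model_def emb_simps flip: power_mult)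
  \<comment> \<open>A square root of -1, needed because \<open>y^2 / x^6\<close> is a cubic in
    \<open>inverse (x^2)\<close> with leading coefficient -1.\<close>
  obtain i where "poly [:1, 0, 1:] i = (0::'k)"
    using alg_closed_imp_poly_has_root[of "[:1, 0, 1:] :: 'k poly"] by auto
  hence "i * i = - 1" by (simp add: eq_neg_iff_add_eq_0 add.commute)
  hence i: "emb i ^ 2 = - 1" using emb_mult[of i i] by (simp add: power2_eq_square emb_simps)
  \<comment> \<open>The substitution \<open>T = 1/x\<^sup>2\<close> turns \<open>(x y)\<^sup>2 = x\<^sup>8 - \<dots>\<close> into a cubic with \<open>s1\<close> and \<open>s2\<close> swapped.\<close>
  define w where "w = emb i * (x * y) / x^4"
  have w2: "w^2 = inverse (x^2)^3 + emb (-s2) * inverse (x^2)^2 + emb s1 * inverse (x^2) + emb (-1)"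
  proof -
    have "w^2 = - (y^2) / x^6"
      using x0 i unfolding w_def by (simp add: power_mult_distrib power_divide field_simps eval_nat_numeral)
    thus ?thesis unfolding y using x0 by (simp add: emb_simps field_simps eval_nat_numeral)
  qed
  have M2: "cubic_model (inverse (x^2)) w (-s2) s1 (-1)"
    using trans_elt_inverse[OF trans_elt_square[OF tx]] qd(2) w2 by (simp add: cubic_model_def)
  have i0: "emb i \<noteq> 0" using i by auto
  have Q1: "E1 = quad (x^2) y"
    unfolding E1 R k
  proof (rule gen_eq_quad[OF cubic_model_square_in_rat[OF M1]])
    show "{x\<^sup>2, y} \<subseteq> quad (x\<^sup>2) y" by (simp add: in_quad)
  qed (auto intro: generate_field.incl)
  have Q2: "E2 = quad (inverse (x^2)) w"
    unfolding E2 R k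
  proof (rule gen_eq_quad[OF cubic_model_square_in_rat[OF M2]])
    note D = kfieldD[OF kfield_quad[OF cubic_model_square_in_rat[OF M2]]]
    have x2: "x^2 \<in> quad (inverse (x^2)) w" using D(10)[OF in_quad(1)] by simp
    have "x * y = inverse (emb i) * w * (x^2)^2" using x0 i0 by (simp add: w_def field_simps)
    moreover have "\<dots> \<in> quad (inverse (x^2)) w" by (intro D x2 in_quad)
    ultimately show "{x\<^sup>2, x * y} \<subseteq> quad (inverse (x\<^sup>2)) w" using x2 by simp
    note G = kfieldD[OF kfield_gen[of "{x\<^sup>2, x * y}"]]
    have g: "x^2 \<in> gen {x\<^sup>2, x * y}" "x * y \<in> gen {x\<^sup>2, x * y}" by (auto intro: generate_field.incl)
    show "inverse (x^2) \<in> gen {x\<^sup>2, x * y}" by (intro G g)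
    have "w = emb i * (x * y) / (x^2)^2" by (simp add: w_def flip: power_mult)
    moreover have "\<dots> \<in> gen {x\<^sup>2, x * y}" by (intro G g)
    ultimately show "w \<in> gen {x\<^sup>2, x * y}" by simp
  qed
  obtain \<phi> OE OF' where "isogeny_of_degree R k 2 E1 OE E2 OF' \<phi> \<or> isogeny_of_degree R k 2 E2 OF' E1 OE \<phi>"
    using isog unfolding isogenous_of_degree_def by blast
  hence "Phi2 (qj 0 1 (-s1) s2 (-1)) (qj 0 1 (-s2) s1 (-1)) = 0"
  proof
    assume "isogeny_of_degree R k 2 E1 OE E2 OF' \<phi>"
    hence "Phi2 (qj 0 1 (-s2) s1 (-1)) (qj 0 1 (-s1) s2 (-1)) = 0"
      unfolding isogeny_of_degree_def R k Q1 Q2 by (intro Phi2_of_cubic_models[OF M1 M2]) blast+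
    thus ?thesis by (subst Phi2_sym)
  next
    assume "isogeny_of_degree R k 2 E2 OF' E1 OE \<phi>"
    thus ?thesis
      unfolding isogeny_of_degree_def R k Q1 Q2 by (intro Phi2_of_cubic_models[OF M2 M1]) blast+
  qed
  thus ?thesis unfolding u v by (rule isog2_of_Phi2[OF disc])
qed

end
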